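(* For all integers $d \geq 3$, there exists a compact Kakeya set $K$ in $\mathbb{R}^d$ such that $\dim_{\mathrm{F}} K = 2$.
   Context: A Kakeya set in $\mathbb{R}^d$ is a set which contains a unit line segment in every possible direction. For a finite non-zero Borel measure $\mu$ on $\mathbb{R}^d$, $\widehat\mu(z)=\int e^{-2\pi i z\cdot x}\,d\mu(x)$, $\mathrm{spt}(\mu)$ is the support of $\mu$, and the Fourier dimension of $\mu$ is $\dim_{\mathrm{F}}\mu = \sup\{s\geq 0 : \exists\, c>0,\ |\widehat\mu(z)|\leq c|z|^{-s/2} \text{ for all } z\neq 0\}$. For $X\subseteq\mathbb{R}^d$, $\dim_{\mathrm{F}} X = \sup\{\min\{\dim_{\mathrm{F}}\mu, d\} : \mathrm{spt}(\mu)\subseteq X\}$, the supremum being over finite non-zero Borel measures $\mu$ supported by $X$. *)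

theory Defs
  imports "HOL-Analysis.Analysis"
begin

definition kakeya_set :: "'a::euclidean_space set \<Rightarrow> bool" where
  "kakeya_set K \<longleftrightarrow> (\<forall>e. norm e = 1 \<longrightarrow> (\<exists>a. closed_segment a (a + e) \<subseteq> K))"

definition nonzero_finite_borel_measure :: "'a::euclidean_space measure \<Rightarrow> bool" where
  "nonzero_finite_borel_measure \<mu> \<longleftrightarrow>
     finite_measure \<mu> \<and> sets \<mu> = sets borel \<and> emeasure \<mu> UNIV \<noteq> 0"

definition measure_spt :: "'a::euclidean_space measure \<Rightarrow> 'a set" where
  "measure_spt \<mu> = {x. \<forall>U. open U \<and> x \<in> U \<longrightarrow> emeasure \<mu> U > 0}"

definition fourier_measure :: "'a::euclidean_space measure \<Rightarrow> 'a \<Rightarrow> complex" where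
  "fourier_measure \<mu> z = (LINT x|\<mu>. exp (- 2 * of_real pi * \<i> * of_real (z \<bullet> x)))"

(* Both suprema are taken in [0, \<infinity>]: the Fourier dimension of a measure may be infinite
   (e.g. for a smooth compactly supported density), and a set that supports no nonzero finite
   measure, i.e. the empty set, gets dimension 0. *)

definition fourier_dim_measure :: "'a::euclidean_space measure \<Rightarrow> ennreal" where
  "fourier_dim_measure \<mu> =
     Sup {ennreal s | s. s \<ge> 0 \<and>
       (\<exists>c>0. \<forall>z. z \<noteq> 0 \<longrightarrow> cmod (fourier_measure \<mu> z) \<le> c * norm z powr (- s / 2))}"

definition fourier_dim :: "'a::euclidean_space set \<Rightarrow> ennreal" where
  "fourier_dim X =
     Sup {min (fourier_dim_measure \<mu>) (of_nat DIM('a)) | \<mu>.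
       nonzero_finite_borel_measure \<mu> \<and> measure_spt \<mu> \<subseteq> X}"

end

theory Submission
  imports Defs "HOL-Probability.Probability"
begin

text \<open>
  Fix two coordinates \<open>i \<noteq> j\<close> and let \<open>K\<close> be the set of all points whose \<open>(i, j)\<close>-projection
  lies in a compact planar Kakeya set of Lebesgue measure zero and whose other coordinates lie in
  \<open>[-1, 1]\<close>. A segment of \<open>K\<close> in a given direction is a planar segment of length at most \<open>1\<close>
  combined with a segment in the cube, so \<open>K\<close> is a Kakeya set.

  Upper bound. If a measure on \<open>K\<close> has Fourier decay \<open>\<bar>z\<bar> powr (- s / 2)\<close> with \<open>s > 2\<close>, then so
  does its image in the plane, because the transform of the image is a restriction of the original
  transform. Since \<open>\<bar>z\<bar> powr (- s)\<close> is integrable at infinity in the plane, the image measure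
  has a square integrable Fourier transform, and such a measure cannot charge the null set that
  carries it. To see this quantitatively, \<open>near_diagonal_mass_le\<close> bounds
  the mass of \<open>\<nu> \<Otimes> \<nu>\<close> at distance \<open>O(\<epsilon>)\<close> from the diagonal by \<open>O(\<epsilon>\<^sup>2)\<close>, using a Gaussian
  average of \<open>\<bar>\<nu>^\<bar>\<^sup>2\<close>, and \<open>Cauchy_Schwarz_cball_energy\<close> turns this into a bound for \<open>\<nu> P\<close>
  by the measure of a small neighbourhood of \<open>P\<close>.

  Lower bound. Choose a slope uniformly, then a point of the corresponding segment with a
  density whose Fourier transform is \<open>O(1 / (1 + u\<^sup>2))\<close>, and the other coordinates uniformly. Whatever
  the positions of the lines are, the transform at the planar frequency \<open>(\<xi>, \<eta>)\<close> is at most twice the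
  average of \<open>1 / (1 + u\<^sup>2)\<close> over \<open>u = (\<xi> + \<eta> * slope) / 2\<close>, which is \<open>O(1 / \<bar>(\<xi>, \<eta>)\<bar>)\<close>; the other
  coordinates contribute \<open>O(1 / \<bar>z $ k\<bar>)\<close> each. This is decay of order \<open>1\<close>, that is, Fourier
  dimension at least \<open>2\<close>.

  The planar set uses the freedom in the positions of the lines. For a slope parameter with binary
  digits \<open>d j\<close>, the line is \<open>y = (\<Sum>j. d j * (x - offset j) / 2 ^ Suc j)\<close> up to an affine change of
  variables. Over a fixed \<open>x\<close>, a long run of indices with \<open>offset j\<close> close to \<open>x\<close> makes the
  digits in that run move the point very little, so the fibre is covered by as many intervals as
  there are choices of the digits before the run, each much shorter than the step of those digits.
\<close>

section \<open>A compact planar Kakeya set of measure zero\<close>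

text \<open>
  Any sequence in \<open>[0, 1]\<close> that comes close to every point and stays there for arbitrarily many
  consecutive indices would do; \<open>frac (sqrt j)\<close> does because the gaps of \<open>sqrt\<close> tend to zero.
\<close>

definition offset :: "nat \<Rightarrow> real" where
  "offset j = frac (sqrt (real j))"

lemma offset_bounds: "0 \<le> offset j" "offset j \<le> 1"
  unfolding offset_def using frac_lt_1[of "sqrt (real j)"] by (auto simp: less_imp_le)

text \<open>
  Near \<open>j = (n + x)\<^sup>2\<close> the fractional part of \<open>sqrt j\<close> is close to \<open>x\<close>, and it takes more
  than \<open>2 * n * \<delta>\<close> steps for \<open>sqrt j\<close> to grow by \<open>\<delta>\<close>.
\<close>

lemma offset_near_on_long_block:
  assumes x: "0 \<le> x" "x < 1" and "\<epsilon> > 0"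
  shows "\<exists>N. \<forall>j\<in>{N..<N + L}. \<bar>x - offset j\<bar> \<le> \<epsilon>"
proof -
  \<comment> \<open>The bound \<open>(1 - x) / 2\<close> keeps \<open>sqrt j\<close> below the next integer, so that \<open>frac\<close> does not wrap around.\<close>
  define \<delta> where "\<delta> = min \<epsilon> ((1 - x) / 2)"
  have \<delta>: "\<delta> > 0" "\<delta> \<le> \<epsilon>" "x + \<delta> < 1"
    using assms by (auto simp: \<delta>_def min_def field_simps)
  obtain n :: nat where n: "real L / (2 * \<delta>) \<le> real n"
    using real_arch_simple by blast
  define N where "N = nat \<lceil>(n + x)\<^sup>2\<rceil>"
  have N: "(n + x)\<^sup>2 \<le> real N" "real N \<le> (n + x)\<^sup>2 + 1"
    unfolding N_def using x by auto
  have "\<bar>x - offset j\<bar> \<le> \<epsilon>" if j: "j \<in> {N..<N + L}" for j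
  proof -
    have "n + x \<le> sqrt (real j)"
      using N(1) j x by (intro real_le_rsqrt) auto
    moreover have "sqrt (real j) \<le> n + x + \<delta>"
    proof (rule real_le_lsqrt)
      have "real j \<le> (n + x)\<^sup>2 + real L"
        using N(2) j by auto
      also have "real L \<le> 2 * \<delta> * n"
        using n \<delta> by (simp add: field_simps)
      also have "(n + x)\<^sup>2 + 2 * \<delta> * n \<le> (n + x + \<delta>)\<^sup>2"
        using \<delta> x by (simp add: power2_eq_square algebra_simps)
      finally show "real j \<le> (n + x + \<delta>)\<^sup>2" by simp
    qed (use \<delta> x in auto)
    moreover from calculation have "\<lfloor>sqrt (real j)\<rfloor> = int n"
      using x \<delta> by (intro floor_unique) auto
    ultimately show ?thesis
      using \<delta> by (auto simp: offset_def frac_def)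
  qed
  then show ?thesis by blast
qed

definition digit_sum :: "nat set \<Rightarrow> real \<Rightarrow> real" where
  "digit_sum A x = (\<Sum>j\<in>A. (x - offset j) / 2 ^ Suc j)"

text \<open>
  Bound for the part of a line that the digits with index at least \<open>N\<close> contribute: exact weights
  for the next \<open>L\<close> digits, and the trivial weight \<open>1\<close> for all later ones.
\<close>

definition tail_bound :: "nat \<Rightarrow> nat \<Rightarrow> real \<Rightarrow> real" where
  "tail_bound N L x = (\<Sum>j\<in>{N..<N + L}. \<bar>x - offset j\<bar> / 2 ^ Suc j) + 1 / 2 ^ (N + L)"

text \<open>
  The union of all lines, thickened by the error made when only \<open>N\<close> digits are known. The factor
  \<open>4\<close> and the shear \<open>2 * x\<close> move the slopes from \<open>[0, 1]\<close> to \<open>[-2, 2]\<close>, an interval with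
  \<open>[-1, 1]\<close> in its interior: parameters \<open>m < 1\<close> then suffice for all slopes that are needed.
\<close>

definition strips :: "nat \<Rightarrow> nat \<Rightarrow> (real \<times> real) set" where
  "strips N L = (\<Union>A\<in>Pow {..<N}. {(x, y). 0 \<le> x \<and> x \<le> 1 \<and>
     \<bar>y + 2 * x - 4 * digit_sum A x\<bar> \<le> 4 * tail_bound N L x})"

text \<open>
  Intersecting closed strips, rather than collecting the lines themselves, gives a compact set
  at no cost: the covers that prove measure zero are covers of this larger set.
\<close>

definition besicovitch :: "(real \<times> real) set" where
  "besicovitch = (\<Inter>N. \<Inter>L. strips N L)"

lemma closed_strips: "closed (strips N L)"
  unfolding strips_def digit_sum_def tail_bound_def
  by (intro closed_UN)
     (auto simp: case_prod_unfold intro!: closed_Collect_conj closed_Collect_le continuous_intros)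

lemma compact_besicovitch: "compact besicovitch"
proof -
  have "besicovitch \<subseteq> strips 0 0"
    by (auto simp: besicovitch_def)
  also have "\<dots> \<subseteq> cbox (0, -10) (1, 10)"
    by (auto simp: strips_def digit_sum_def tail_bound_def)
  finally have "bounded besicovitch"
    using bounded_cbox bounded_subset by blast
  moreover have "closed besicovitch"
    unfolding besicovitch_def by (intro closed_INT ballI closed_strips)
  ultimately show ?thesis
    by (simp add: compact_eq_bounded_closed)
qed

lemma emeasure_strips_slice:
  "emeasure lborel (Pair x -` strips N L) \<le> ennreal (8 * 2 ^ N * tail_bound N L x)"
proof -
  have t: "tail_bound N L x \<ge> 0"
    unfolding tail_bound_def by (intro add_nonneg_nonneg sum_nonneg) auto
  define I where "I A = {4 * digit_sum A x - 2 * x - 4 * tail_bound N L x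
    .. 4 * digit_sum A x - 2 * x + 4 * tail_bound N L x}" for A
  have "Pair x -` strips N L \<subseteq> (\<Union>A\<in>Pow {..<N}. I A)"
    by (auto simp: strips_def I_def abs_le_iff algebra_simps)
  then have "emeasure lborel (Pair x -` strips N L) \<le> emeasure lborel (\<Union>A\<in>Pow {..<N}. I A)"
    by (intro emeasure_mono) (auto simp: I_def intro!: sets.finite_UN)
  also have "\<dots> \<le> (\<Sum>A\<in>Pow {..<N}. emeasure lborel (I A))"
    by (intro emeasure_subadditive_finite) (auto simp: I_def)
  also have "\<dots> = (\<Sum>A\<in>Pow {..<N}. ennreal (8 * tail_bound N L x))"
    using t by (intro sum.cong) (auto simp: I_def)
  also have "\<dots> = ennreal (8 * 2 ^ N * tail_bound N L x)"
    using t by (simp add: card_Pow ennreal_mult[symmetric] ennreal_of_nat_eq_real_of_nat mult_ac)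
  finally show ?thesis .
qed

text \<open>
  The fibre over \<open>x\<close> is covered by \<open>2 ^ N\<close> intervals, whose total length is small because the
  weights of the next \<open>L\<close> digits carry an extra factor \<open>\<epsilon>\<close>.
\<close>

lemma scaled_tail_bound_le:
  assumes "\<And>j. j \<in> {N..<N + L} \<Longrightarrow> \<bar>x - offset j\<bar> \<le> \<epsilon>" and "\<epsilon> \<ge> 0"
  shows "2 ^ N * tail_bound N L x \<le> \<epsilon> + 1 / 2 ^ L"
proof -
  have geo: "(\<Sum>j\<in>{N..<N + L}. 1 / 2 ^ Suc j :: real) = 1 / 2 ^ N - 1 / 2 ^ (N + L)"
  proof (induction L)
    case (Suc L)
    have "(\<Sum>j\<in>{N..<N + Suc L}. 1 / 2 ^ Suc j :: real)
        = (\<Sum>j\<in>{N..<N + L}. 1 / 2 ^ Suc j) + 1 / 2 ^ Suc (N + L)"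
      by simp
    then show ?case
      unfolding Suc by simp
  qed simp
  have "(\<Sum>j\<in>{N..<N + L}. \<bar>x - offset j\<bar> / 2 ^ Suc j) \<le> (\<Sum>j\<in>{N..<N + L}. \<epsilon> * (1 / 2 ^ Suc j))"
    using assms(1) by (intro sum_mono) (simp add: divide_right_mono)
  also have "\<dots> = \<epsilon> * (1 / 2 ^ N - 1 / 2 ^ (N + L))"
    by (simp only: geo sum_distrib_left[symmetric])
  also have "\<dots> \<le> \<epsilon> / 2 ^ N"
    using assms(2) by (simp add: field_simps)
  finally have "2 ^ N * tail_bound N L x \<le> 2 ^ N * (\<epsilon> / 2 ^ N + 1 / 2 ^ (N + L))"
    unfolding tail_bound_def by (intro mult_left_mono) auto
  also have "\<dots> = \<epsilon> + 1 / 2 ^ L"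
    by (simp add: distrib_left power_add)
  finally show ?thesis .
qed

text \<open>
  The blocks of \<open>offset_near_on_long_block\<close> approach \<open>x\<close> from above, which is impossible for
  \<open>x = 1\<close>. A single fibre does not affect the measure of the set.
\<close>

lemma emeasure_besicovitch_slice:
  assumes x: "x \<noteq> 1"
  shows "emeasure lborel (Pair x -` besicovitch) = 0"
proof (cases "0 \<le> x \<and> x < 1")
  case True
  have le: "emeasure lborel (Pair x -` besicovitch) \<le> ennreal (16 * (1 / 2 ^ L))" for L
  proof -
    obtain N where N: "\<forall>j\<in>{N..<N + L}. \<bar>x - offset j\<bar> \<le> 1 / 2 ^ L"
      using offset_near_on_long_block[of x "1 / 2 ^ L" L] True by auto
    have "emeasure lborel (Pair x -` besicovitch) \<le> emeasure lborel (Pair x -` strips N L)"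
    proof (intro emeasure_mono)
      show "Pair x -` strips N L \<in> sets lborel" unfolding sets_lborel
        by (intro borel_closed closed_vimage continuous_intros closed_strips)
    qed (auto simp: besicovitch_def)
    also have "\<dots> \<le> ennreal (8 * 2 ^ N * tail_bound N L x)"
      by (rule emeasure_strips_slice)
    also have "\<dots> \<le> ennreal (16 * (1 / 2 ^ L))"
      using scaled_tail_bound_le[of N L x "1 / 2 ^ L"] N by (intro ennreal_leI) auto
    finally show ?thesis .
  qed
  have "(\<lambda>L. ennreal (16 * (1 / 2 ^ L))) \<longlonglongrightarrow> ennreal (16 * 0)"
    by (intro tendsto_ennrealI tendsto_mult tendsto_const) real_asymp
  then have "emeasure lborel (Pair x -` besicovitch) \<le> ennreal (16 * 0)"
    by (rule Lim_bounded2) (use le in auto)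
  then show ?thesis by simp
next
  case False
  then have "Pair x -` besicovitch = {}"
    using x by (auto simp: besicovitch_def strips_def)
  then show ?thesis by simp
qed

lemma emeasure_besicovitch: "emeasure lborel besicovitch = 0"
proof -
  have bes: "besicovitch \<in> sets borel"
    by (intro borel_closed compact_imp_closed compact_besicovitch)
  have "emeasure lborel besicovitch = (\<integral>\<^sup>+x. emeasure lborel (Pair x -` besicovitch) \<partial>lborel)"
    using lborel.emeasure_pair_measure_alt[of besicovitch "lborel :: real measure"] bes
    by (simp only: lborel_prod sets_lborel)
  also have "\<dots> = (\<integral>\<^sup>+x. 0 \<partial>(lborel :: real measure))"
  proof (rule nn_integral_cong_AE)
    show "AE x in lborel. emeasure lborel (Pair x -` besicovitch) = 0"
      using AE_lborel_singleton[of "1 :: real"] by eventually_elim (rule emeasure_besicovitch_slice)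
  qed
  finally show ?thesis by simp
qed

text \<open>
  The digits are given by a formula, and not chosen, so that the position of a line is a Borel
  function of its slope. This is what the measure on the Kakeya set requires.
\<close>

definition binary_digit :: "nat \<Rightarrow> real \<Rightarrow> real" where
  "binary_digit j m = of_int (\<lfloor>2 ^ Suc j * m\<rfloor> - 2 * \<lfloor>2 ^ j * m\<rfloor>)"

lemma binary_digit_cases: "binary_digit j m = 0 \<or> binary_digit j m = 1"
proof -
  have "\<lfloor>2 ^ Suc j * m\<rfloor> - 2 * \<lfloor>2 ^ j * m\<rfloor> = 0 \<or> \<lfloor>2 ^ Suc j * m\<rfloor> - 2 * \<lfloor>2 ^ j * m\<rfloor> = 1"
    unfolding power_Suc mult.assoc by linarith
  then show ?thesis
    by (auto simp: binary_digit_def)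
qed

lemma measurable_binary_digit [measurable]: "binary_digit j \<in> borel_measurable borel"
  unfolding binary_digit_def by measurable

lemma binary_digits_sums:
  assumes "0 \<le> m" "m < 1"
  shows "(\<lambda>j. binary_digit j m / 2 ^ Suc j) sums m"
proof -
  \<comment> \<open>The partial sums telescope.\<close>
  have part: "(\<Sum>j<n. binary_digit j m / 2 ^ Suc j) = of_int \<lfloor>2 ^ n * m\<rfloor> / 2 ^ n" for n
  proof (induction n)
    case 0
    have "\<lfloor>m\<rfloor> = 0" using assms by linarith
    then show ?case by simp
  next
    case (Suc n)
    then show ?case by (simp add: binary_digit_def field_simps)
  qed
  have "(\<lambda>n. of_int \<lfloor>2 ^ n * m\<rfloor> / 2 ^ n) \<longlonglongrightarrow> m"
  proof (rule tendsto_sandwich[of "\<lambda>n. m - 1 / 2 ^ n" _ _ "\<lambda>n. m"])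
    show "\<forall>\<^sub>F n in sequentially. m - 1 / 2 ^ n \<le> of_int \<lfloor>2 ^ n * m\<rfloor> / 2 ^ n"
    proof (intro always_eventually allI)
      fix n
      have "2 ^ n * m - 1 \<le> of_int \<lfloor>2 ^ n * m\<rfloor>" by linarith
      then have "(2 ^ n * m - 1) / 2 ^ n \<le> of_int \<lfloor>2 ^ n * m\<rfloor> / 2 ^ n"
        by (intro divide_right_mono) auto
      then show "m - 1 / 2 ^ n \<le> of_int \<lfloor>2 ^ n * m\<rfloor> / 2 ^ n"
        by (simp add: diff_divide_distrib)
    qed
    show "\<forall>\<^sub>F n in sequentially. of_int \<lfloor>2 ^ n * m\<rfloor> / 2 ^ n \<le> m"
      by (intro always_eventually allI) (simp add: field_simps)
    show "(\<lambda>n. m - 1 / 2 ^ n) \<longlonglongrightarrow> m" by real_asymp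
  qed auto
  then show ?thesis by (simp only: sums_def part)
qed

definition intercept :: "real \<Rightarrow> real" where
  "intercept m = - 4 * (\<Sum>j. offset j * binary_digit j m / 2 ^ Suc j)"

lemma measurable_intercept [measurable]: "intercept \<in> borel_measurable borel"
  unfolding intercept_def by measurable

lemma summable_dyadic: "summable (\<lambda>j. 1 / 2 ^ Suc j :: real)"
  using power_half_series by (simp add: sums_iff power_one_over)

lemma digit_tail_le:
  assumes "\<And>j. \<bar>a j\<bar> \<le> 1"
  shows "\<bar>(\<Sum>j. a j / 2 ^ Suc j) - (\<Sum>j<N. a j / 2 ^ Suc j)\<bar>
     \<le> (\<Sum>j\<in>{N..<N + L}. \<bar>a j\<bar> / 2 ^ Suc j) + (1 / 2 ^ (N + L) :: real)"
proof -
  define f where "f j = a j / 2 ^ Suc j" for j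
  have af: "\<bar>f j\<bar> = \<bar>a j\<bar> / 2 ^ Suc j" for j by (simp add: f_def)
  have fle: "\<bar>f j\<bar> \<le> 1 / 2 ^ Suc j" for j
    using assms[of j] unfolding af by (intro divide_right_mono) auto
  have sf: "summable (\<lambda>j. \<bar>f j\<bar>)"
    by (rule summable_comparison_test'[OF summable_dyadic, of 0]) (use fle in auto)
  then have f: "summable f" by (rule summable_rabs_cancel)
  have "suminf f - sum f {..<N} = (\<Sum>j\<in>{N..<N + L}. f j) + (\<Sum>j. f (j + (N + L)))"
    using suminf_split_initial_segment[OF f, of "N + L"]
      sum.union_disjoint[of "{..<N}" "{N..<N+L}" f]
    by (simp add: ivl_disj_un ivl_disj_int)
  moreover have "\<bar>\<Sum>j\<in>{N..<N + L}. f j\<bar> \<le> (\<Sum>j\<in>{N..<N + L}. \<bar>a j\<bar> / 2 ^ Suc j)"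
    unfolding af[symmetric] by (rule sum_abs)
  moreover have "\<bar>\<Sum>j. f (j + (N + L))\<bar> \<le> 1 / 2 ^ (N + L)"
  proof -
    have S: "(\<lambda>j. (1 / 2 ^ (N + L)) * (1/2) ^ Suc j :: real) sums ((1 / 2 ^ (N + L)) * 1)"
      by (intro sums_mult power_half_series)
    have sf': "summable (\<lambda>j. \<bar>f (j + (N + L))\<bar>)"
      using sf by (subst summable_iff_shift)
    have "\<bar>\<Sum>j. f (j + (N + L))\<bar> \<le> (\<Sum>j. \<bar>f (j + (N + L))\<bar>)"
      by (rule summable_rabs[OF sf'])
    also have "\<dots> \<le> (\<Sum>j. (1 / 2 ^ (N + L)) * (1/2) ^ Suc j)"
    proof (rule suminf_le[OF _ sf' sums_summable[OF S]])
      fix j show "\<bar>f (j + (N + L))\<bar> \<le> (1 / 2 ^ (N + L)) * (1/2) ^ Suc j"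
        using fle[of "j + (N + L)"] by (simp add: power_add power_one_over field_simps)
    qed
    also have "\<dots> = 1 / 2 ^ (N + L)" using S by (simp add: sums_iff)
    finally show ?thesis .
  qed
  ultimately show ?thesis unfolding f_def by linarith
qed

lemma line_in_besicovitch:
  assumes m: "0 \<le> m" "m < 1" and x: "0 \<le> x" "x \<le> 1"
  shows "(x, x * (4 * m - 2) + intercept m) \<in> besicovitch"
  unfolding besicovitch_def
proof (intro INT_I)
  fix N L
  define a where "a j = (x - offset j) * binary_digit j m" for j
  define A where "A = {j\<in>{..<N}. binary_digit j m = 1}"
  have dig: "\<bar>x - offset j\<bar> \<le> 1" for j
    using offset_bounds[of j] x by auto
  have ax: "\<bar>a j\<bar> \<le> \<bar>x - offset j\<bar>" for j
    using binary_digit_cases[of j m] by (auto simp: a_def)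
  have so: "summable (\<lambda>j. offset j * binary_digit j m / 2 ^ Suc j)"
  proof (rule summable_comparison_test'[OF summable_dyadic, of 0])
    fix j show "norm (offset j * binary_digit j m / 2 ^ Suc j) \<le> 1 / 2 ^ Suc j"
      using binary_digit_cases[of j m] offset_bounds[of j]
      by (auto simp: divide_right_mono)
  qed
  have "(\<Sum>j. a j / 2 ^ Suc j) = (\<Sum>j. x * (binary_digit j m / 2 ^ Suc j) - offset j * binary_digit j m / 2 ^ Suc j)"
    by (simp add: a_def field_simps)
  also have "\<dots> = x * m - (\<Sum>j. offset j * binary_digit j m / 2 ^ Suc j)"
    using binary_digits_sums[OF m] so
    by (subst suminf_diff[symmetric])
       (simp_all only: suminf_mult summable_mult sums_iff)
  finally have eq: "4 * (\<Sum>j. a j / 2 ^ Suc j) = x * (4 * m - 2) + intercept m + 2 * x"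
    by (simp add: intercept_def algebra_simps)
  have "digit_sum A x = (\<Sum>j<N. a j / 2 ^ Suc j)"
    unfolding digit_sum_def A_def using binary_digit_cases
    by (intro sum.mono_neutral_cong_left) (auto simp: a_def)
  then have "\<bar>(\<Sum>j. a j / 2 ^ Suc j) - digit_sum A x\<bar>
      \<le> (\<Sum>j\<in>{N..<N + L}. \<bar>a j\<bar> / 2 ^ Suc j) + 1 / 2 ^ (N + L)"
    using digit_tail_le[of a N L] ax dig by (simp add: order_trans[OF ax dig])
  also have "\<dots> \<le> tail_bound N L x"
    unfolding tail_bound_def by (intro add_mono sum_mono divide_right_mono ax) auto
  finally have "\<bar>x * (4 * m - 2) + intercept m + 2 * x - 4 * digit_sum A x\<bar> \<le> 4 * tail_bound N L x"
    unfolding eq[symmetric] by linarith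
  moreover have "A \<in> Pow {..<N}" by (auto simp: A_def)
  ultimately show "(x, x * (4 * m - 2) + intercept m) \<in> strips N L"
    unfolding strips_def using x by blast
qed

text \<open>
  The lines run over \<open>x \<in> [0, 1]\<close>, so a segment whose first coordinate changes by \<open>u\<close> fits if it
  starts at \<open>x = 0\<close> for \<open>u \<ge> 0\<close> and at \<open>x = 1\<close> for \<open>u < 0\<close>. For \<open>u = 0\<close> the segment is a point.
\<close>

lemma segment_in_besicovitch:
  assumes "\<bar>v\<bar> \<le> \<bar>u\<bar>" "\<bar>u\<bar> \<le> 1"
  shows "\<exists>a. \<forall>s\<in>{0..1}. a + s *\<^sub>R (u, v) \<in> besicovitch"
proof -
  define m where "m = (v / u + 2) / 4"
  have q: "\<bar>v / u\<bar> \<le> 1" using assms by (cases "u = 0") (auto simp: abs_divide divide_simps)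
  then have m: "0 \<le> m \<and> m < 1" unfolding m_def abs_le_iff by simp
  have v: "v = u * (4 * m - 2)" using assms by (cases "u = 0") (auto simp: m_def field_simps)
  define x0 where "x0 = (if u \<ge> 0 then 0 else 1 :: real)"
  have "(x0, x0 * (4 * m - 2) + intercept m) + s *\<^sub>R (u, v) \<in> besicovitch" if s: "s \<in> {0..1}" for s
  proof -
    have "\<bar>s * u\<bar> \<le> 1" using s assms by (simp add: abs_mult mult_le_one)
    then have "0 \<le> x0 + s * u" "x0 + s * u \<le> 1"
      using s by (auto simp: x0_def mult_nonneg_nonpos zero_le_mult_iff split: if_splits)
    from line_in_besicovitch[of m, OF _ _ this] m show ?thesis
      by (simp add: v algebra_simps)
  qed
  then show ?thesis by blast
qed

section \<open>Measures with square integrable Fourier transform do not charge null sets\<close>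

text \<open>
  Apply the Cauchy-Schwarz inequality to \<open>f x = \<nu> (cball x \<epsilon>)\<close> on \<open>U\<close>. By Fubini, the integral of \<open>f\<close>
  over \<open>U\<close> is at least \<open>\<nu> P\<close> times the volume of a ball, since \<open>U\<close> contains the balls centred in
  \<open>P\<close>. The integral of \<open>f\<^sup>2\<close> counts triples \<open>(y, y', x)\<close> with \<open>x\<close> close to both \<open>y\<close> and \<open>y'\<close>, which
  forces \<open>y\<close> and \<open>y'\<close> to be close to each other.
\<close>

lemma Cauchy_Schwarz_cball_energy:
  fixes \<nu> :: "'a::euclidean_space measure"
  assumes "finite_measure \<nu>" and [measurable_cong]: "sets \<nu> = sets borel"
    and [measurable]: "P \<in> sets borel" "U \<in> sets borel"
    and U: "(\<Union>y\<in>P. cball y \<epsilon>) \<subseteq> U" and "\<epsilon> > 0"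
  shows "(emeasure \<nu> P)\<^sup>2 * emeasure lborel (cball (0::'a) \<epsilon>)
    \<le> emeasure lborel U * emeasure (\<nu> \<Otimes>\<^sub>M \<nu>) {p. dist (fst p) (snd p) \<le> 2 * \<epsilon>}"
proof -
  interpret \<nu>: finite_measure \<nu> by fact
  interpret \<nu>\<nu>: pair_sigma_finite \<nu> \<nu> ..
  interpret \<nu>2: finite_measure "\<nu> \<Otimes>\<^sub>M \<nu>"
    by (intro finite_measure_pair_measure) (fact assms)+
  interpret Q1: pair_sigma_finite \<nu> "lborel :: 'a measure" ..
  interpret Q2: pair_sigma_finite "\<nu> \<Otimes>\<^sub>M \<nu>" "lborel :: 'a measure" ..
  define B where "B = emeasure lborel (cball (0::'a) \<epsilon>)"
  have B: "emeasure lborel (cball y \<epsilon>) = B" for y :: 'a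
    using \<open>\<epsilon> > 0\<close> by (simp add: B_def emeasure_cball)
  have Bpos: "B \<noteq> 0" "B \<noteq> \<top>"
    using \<open>\<epsilon> > 0\<close> unit_ball_vol_pos[of "real DIM('a)"]
    by (auto simp: B_def emeasure_cball simp del: unit_ball_vol_pos)
  have sp: "space \<nu> = UNIV" using sets_eq_imp_space_eq[OF assms(2)] by simp
  define D where "D = {p :: 'a \<times> 'a. dist (fst p) (snd p) \<le> 2 * \<epsilon>}"
  have Dm: "D \<in> sets (\<nu> \<Otimes>\<^sub>M \<nu>)"
  proof -
    have "{p \<in> space (\<nu> \<Otimes>\<^sub>M \<nu>). dist (fst p) (snd p) \<le> 2 * \<epsilon>} \<in> sets (\<nu> \<Otimes>\<^sub>M \<nu>)"
      by measurable
    then show ?thesis by (simp add: D_def space_pair_measure sp)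
  qed
  define f where "f x = emeasure \<nu> (cball x \<epsilon>)" for x
  have fi: "f x = (\<integral>\<^sup>+y. indicator {p. dist (fst p) (snd p) \<le> \<epsilon>} (y, x) \<partial>\<nu>)" for x
  proof -
    have "f x = (\<integral>\<^sup>+y. indicator (cball x \<epsilon>) y \<partial>\<nu>)"
      unfolding f_def by (subst nn_integral_indicator) auto
    also have "\<dots> = (\<integral>\<^sup>+y. indicator {p. dist (fst p) (snd p) \<le> \<epsilon>} (y, x) \<partial>\<nu>)"
      by (intro nn_integral_cong) (auto simp: indicator_def dist_commute)
    finally show ?thesis .
  qed
  have E [measurable]: "{p :: 'a \<times> 'a. dist (fst p) (snd p) \<le> \<epsilon>} \<in> sets (borel \<Otimes>\<^sub>M borel)"
    unfolding borel_prod by (intro borel_closed closed_Collect_le continuous_intros)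
  have [measurable]: "f \<in> borel_measurable borel"
    unfolding fi by measurable
  have lower: "emeasure \<nu> P * B \<le> (\<integral>\<^sup>+x. f x * indicator U x \<partial>lborel)"
  proof -
    have "emeasure \<nu> P * B = (\<integral>\<^sup>+y. B * indicator P y \<partial>\<nu>)"
      by (subst nn_integral_cmult_indicator) (auto simp: mult.commute)
    also have "\<dots> \<le> (\<integral>\<^sup>+y. \<integral>\<^sup>+x. indicator {p. dist (fst p) (snd p) \<le> \<epsilon>} (y, x) * indicator U x \<partial>lborel \<partial>\<nu>)"
    proof (intro nn_integral_mono)
      fix y
      show "B * indicator P y \<le> (\<integral>\<^sup>+x. indicator {p. dist (fst p) (snd p) \<le> \<epsilon>} (y, x) * indicator U x \<partial>lborel)"
      proof (cases "y \<in> P")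
        case True
        have "B * indicator P y = (\<integral>\<^sup>+x. indicator (cball y \<epsilon>) x \<partial>lborel)"
          using True by (simp add: B)
        also have "\<dots> \<le> (\<integral>\<^sup>+x. indicator {p. dist (fst p) (snd p) \<le> \<epsilon>} (y, x) * indicator U x \<partial>lborel)"
          using U[THEN subsetD, OF UN_I, OF True] True
          by (intro nn_integral_mono) (auto simp: indicator_def)
        finally show ?thesis .
      qed simp
    qed
    also have "\<dots> = (\<integral>\<^sup>+x. \<integral>\<^sup>+y. indicator {p. dist (fst p) (snd p) \<le> \<epsilon>} (y, x) * indicator U x \<partial>\<nu> \<partial>lborel)"
      by (intro Q1.Fubini'[symmetric]) measurable
    also have "\<dots> = (\<integral>\<^sup>+x. f x * indicator U x \<partial>lborel)"
      by (intro nn_integral_cong) (simp add: fi nn_integral_multc)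
    finally show ?thesis .
  qed
  have upper: "(\<integral>\<^sup>+x. (f x)\<^sup>2 \<partial>lborel) \<le> B * emeasure (\<nu> \<Otimes>\<^sub>M \<nu>) D"
  proof -
    have "(f x)\<^sup>2 = (\<integral>\<^sup>+p. indicator {q. dist (fst (fst q)) (snd q) \<le> \<epsilon> \<and> dist (snd (fst q)) (snd q) \<le> \<epsilon>} (p, x) \<partial>(\<nu> \<Otimes>\<^sub>M \<nu>))" for x
    proof -
      have "(f x)\<^sup>2 = emeasure (\<nu> \<Otimes>\<^sub>M \<nu>) (cball x \<epsilon> \<times> cball x \<epsilon>)"
        by (subst \<nu>.emeasure_pair_measure_Times) (auto simp: f_def power2_eq_square)
      also have "\<dots> = (\<integral>\<^sup>+p. indicator (cball x \<epsilon> \<times> cball x \<epsilon>) p \<partial>(\<nu> \<Otimes>\<^sub>M \<nu>))"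
        by (subst nn_integral_indicator) auto
      also have "\<dots> = (\<integral>\<^sup>+p. indicator {q. dist (fst (fst q)) (snd q) \<le> \<epsilon> \<and> dist (snd (fst q)) (snd q) \<le> \<epsilon>} (p, x) \<partial>(\<nu> \<Otimes>\<^sub>M \<nu>))"
        by (intro nn_integral_cong) (auto simp: indicator_def dist_commute)
      finally show ?thesis .
    qed
    then have "(\<integral>\<^sup>+x. (f x)\<^sup>2 \<partial>lborel) = (\<integral>\<^sup>+x. \<integral>\<^sup>+p. indicator {q. dist (fst (fst q)) (snd q) \<le> \<epsilon> \<and> dist (snd (fst q)) (snd q) \<le> \<epsilon>} (p, x) \<partial>(\<nu> \<Otimes>\<^sub>M \<nu>) \<partial>lborel)"
      by simp
    also have "\<dots> = (\<integral>\<^sup>+p. \<integral>\<^sup>+x. indicator {q. dist (fst (fst q)) (snd q) \<le> \<epsilon> \<and> dist (snd (fst q)) (snd q) \<le> \<epsilon>} (p, x) \<partial>lborel \<partial>(\<nu> \<Otimes>\<^sub>M \<nu>))"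
    proof (intro Q2.Fubini')
      have "{q :: ('a \<times> 'a) \<times> 'a. dist (fst (fst q)) (snd q) \<le> \<epsilon> \<and> dist (snd (fst q)) (snd q) \<le> \<epsilon>} \<in> sets ((borel \<Otimes>\<^sub>M borel) \<Otimes>\<^sub>M borel)"
        unfolding borel_prod by (intro borel_closed closed_Collect_conj closed_Collect_le continuous_intros)
      then show "(\<lambda>(x, y). indicator {q. dist (fst (fst q)) (snd q) \<le> \<epsilon> \<and> dist (snd (fst q)) (snd q) \<le> \<epsilon>} (x, y))
          \<in> borel_measurable ((\<nu> \<Otimes>\<^sub>M \<nu>) \<Otimes>\<^sub>M lborel)"
        by measurable
    qed
    also have "\<dots> \<le> (\<integral>\<^sup>+p. B * indicator D p \<partial>(\<nu> \<Otimes>\<^sub>M \<nu>))"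
    proof (intro nn_integral_mono)
      fix p :: "'a \<times> 'a"
      show "(\<integral>\<^sup>+x. indicator {q. dist (fst (fst q)) (snd q) \<le> \<epsilon> \<and> dist (snd (fst q)) (snd q) \<le> \<epsilon>} (p, x) \<partial>lborel) \<le> B * indicator D p"
      proof (cases "p \<in> D")
        case True
        have "(\<integral>\<^sup>+x. indicator {q. dist (fst (fst q)) (snd q) \<le> \<epsilon> \<and> dist (snd (fst q)) (snd q) \<le> \<epsilon>} (p, x) \<partial>lborel)
           \<le> (\<integral>\<^sup>+x. indicator (cball (fst p) \<epsilon>) x \<partial>lborel)"
          by (intro nn_integral_mono) (auto simp: indicator_def)
        then show ?thesis using True by (simp add: B)
      next
        case False
        have "\<not> (dist (fst p) x \<le> \<epsilon> \<and> dist (snd p) x \<le> \<epsilon>)" for x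
          using False dist_triangle2[of "fst p" "snd p" x] by (auto simp: D_def)
        then have "indicator {q. dist (fst (fst q)) (snd q) \<le> \<epsilon> \<and> dist (snd (fst q)) (snd q) \<le> \<epsilon>} (p, x) = (0::ennreal)" for x
          by (simp add: indicator_def)
        then show ?thesis by (simp only: nn_integral_const) simp
      qed
    qed
    also have "\<dots> = B * emeasure (\<nu> \<Otimes>\<^sub>M \<nu>) D"
      using Dm by (subst nn_integral_cmult_indicator) auto
    finally show ?thesis .
  qed
  have "(emeasure \<nu> P * B)\<^sup>2 \<le> (\<integral>\<^sup>+x. f x * indicator U x \<partial>lborel)\<^sup>2"
    using lower by (rule power_mono) simp
  also have "\<dots> \<le> (\<integral>\<^sup>+x. (f x)\<^sup>2 \<partial>lborel) * (\<integral>\<^sup>+x. (indicator U x)\<^sup>2 \<partial>lborel)"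
    by (rule Cauchy_Schwarz_nn_integral) auto
  also have "(\<integral>\<^sup>+x. (indicator U x)\<^sup>2 \<partial>lborel) = emeasure lborel U"
  proof -
    have "(\<integral>\<^sup>+x. (indicator U x)\<^sup>2 \<partial>lborel) = (\<integral>\<^sup>+x. indicator U x \<partial>lborel)"
      by (intro nn_integral_cong) (auto simp: indicator_def)
    then show ?thesis by simp
  qed
  also have "(\<integral>\<^sup>+x. (f x)\<^sup>2 \<partial>lborel) * emeasure lborel U \<le> B * emeasure (\<nu> \<Otimes>\<^sub>M \<nu>) D * emeasure lborel U"
    by (intro mult_right_mono upper) simp
  finally have "B * ((emeasure \<nu> P)\<^sup>2 * B) \<le> B * (emeasure lborel U * emeasure (\<nu> \<Otimes>\<^sub>M \<nu>) D)"
    by (simp add: power2_eq_square mult_ac)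
  then show ?thesis
    using Bpos unfolding B_def D_def by (subst (asm) ennreal_mult_le_mult_iff) auto
qed

lemma char_std_normal_pair:
  fixes v :: "real \<times> real"
  shows "(LINT g|(std_normal_distribution \<Otimes>\<^sub>M std_normal_distribution). iexp (g \<bullet> v))
    = of_real (exp (- (norm v)\<^sup>2 / 2))"
proof -
  interpret N: prob_space std_normal_distribution
    by (rule prob_space_normal_density) simp
  interpret NN: pair_prob_space std_normal_distribution std_normal_distribution ..
  have ch: "(LINT x|std_normal_distribution. iexp (x * t)) = of_real (exp (- t\<^sup>2 / 2))" for t
    using fun_cong[OF char_std_normal_distribution, of t] by (simp add: char_def mult.commute)
  have "(LINT g|(std_normal_distribution \<Otimes>\<^sub>M std_normal_distribution). iexp (g \<bullet> v))
    = (LINT g|(std_normal_distribution \<Otimes>\<^sub>M std_normal_distribution). iexp (fst g * fst v) * iexp (snd g * snd v))"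
    by (simp add: inner_prod_def exp_add[symmetric] distrib_left)
  also have "\<dots> = (LINT x|std_normal_distribution. LINT y|std_normal_distribution.
       iexp (x * fst v) * iexp (y * snd v))"
    by (subst NN.integral_fst'[symmetric])
       (auto intro!: NN.integrable_const_bound[where B = 1] simp: norm_mult)
  also have "\<dots> = of_real (exp (- (fst v)\<^sup>2 / 2) * exp (- (snd v)\<^sup>2 / 2))"
    by (simp only: ch integral_mult_right_zero integral_mult_left_zero of_real_mult[symmetric])
  also have "exp (- (fst v)\<^sup>2 / 2) * exp (- (snd v)\<^sup>2 / 2) = exp (- (norm v)\<^sup>2 / 2)"
    by (simp add: exp_add[symmetric] norm_prod_def add_divide_distrib)
  finally show ?thesis .
qed

lemma fourier_measure_alt:
  "fourier_measure \<mu> z = (LINT x|\<mu>. iexp (- 2 * pi * (z \<bullet> x)))"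
  unfolding fourier_measure_def by (simp add: mult_ac)

lemma norm_fourier_measure_le:
  assumes "finite_measure \<mu>"
  shows "cmod (fourier_measure \<mu> z) \<le> measure \<mu> (space \<mu>)"
proof -
  interpret finite_measure \<mu> by fact
  have "cmod (fourier_measure \<mu> z) \<le> (LINT x|\<mu>. cmod (iexp (- 2 * pi * (z \<bullet> x))))"
    unfolding fourier_measure_alt by (rule integral_norm_bound)
  then show ?thesis by simp
qed

lemma measurable_fourier_measure:
  fixes \<nu> :: "'a::euclidean_space measure"
  assumes "finite_measure \<nu>" and [measurable_cong]: "sets \<nu> = sets borel"
  shows "fourier_measure \<nu> \<in> borel_measurable borel"
proof -
  interpret finite_measure \<nu> by fact
  show ?thesis unfolding fourier_measure_alt[abs_def] by measurable
qed

text \<open>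
  Write \<open>\<bar>\<nu>^\<bar>\<^sup>2\<close> as a double integral over \<open>\<nu> \<Otimes> \<nu>\<close> and integrate the Gaussian variable first. The
  Gaussian is chosen since its transform is positive and bounded below near the origin, so the right
  hand side dominates the mass near the diagonal.
\<close>

lemma gaussian_energy_identity:
  fixes \<nu> :: "(real \<times> real) measure"
  assumes "finite_measure \<nu>" and [measurable_cong]: "sets \<nu> = sets borel"
  shows "(LINT g|(std_normal_distribution \<Otimes>\<^sub>M std_normal_distribution). (cmod (fourier_measure \<nu> (r *\<^sub>R g)))\<^sup>2)
    = (LINT p|(\<nu> \<Otimes>\<^sub>M \<nu>). exp (- (2 * pi * r * dist (fst p) (snd p))\<^sup>2 / 2))"
proof -
  let ?N = std_normal_distribution
  interpret N: prob_space ?N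
    by (rule prob_space_normal_density) simp
  interpret NN: pair_prob_space ?N ?N ..
  interpret \<nu>: finite_measure \<nu> by fact
  interpret \<nu>\<nu>: pair_sigma_finite \<nu> \<nu> ..
  interpret \<nu>2: finite_measure "\<nu> \<Otimes>\<^sub>M \<nu>"
    by (intro finite_measure_pair_measure) (fact assms)+
  interpret Q: pair_sigma_finite "?N \<Otimes>\<^sub>M ?N" "\<nu> \<Otimes>\<^sub>M \<nu>" ..
  interpret Q: finite_measure "(?N \<Otimes>\<^sub>M ?N) \<Otimes>\<^sub>M (\<nu> \<Otimes>\<^sub>M \<nu>)"
    by (intro finite_measure_pair_measure) unfold_locales
  have cnj_fourier: "cnj (fourier_measure \<nu> z) = (LINT y|\<nu>. iexp (2 * pi * (z \<bullet> y)))" for z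
    unfolding fourier_measure_alt Bochner_Integration.integral_cnj[symmetric]
    by (simp add: exp_cnj)
  have sq: "of_real ((cmod (fourier_measure \<nu> (r *\<^sub>R g)))\<^sup>2)
      = (LINT p|(\<nu> \<Otimes>\<^sub>M \<nu>). iexp (g \<bullet> ((2 * pi * r) *\<^sub>R (snd p - fst p))))" for g
  proof -
    have "of_real ((cmod (fourier_measure \<nu> (r *\<^sub>R g)))\<^sup>2)
        = fourier_measure \<nu> (r *\<^sub>R g) * cnj (fourier_measure \<nu> (r *\<^sub>R g))"
      by (rule complex_norm_square)
    also have "\<dots> = (LINT x|\<nu>. LINT y|\<nu>. iexp (- 2 * pi * (r *\<^sub>R g \<bullet> x)) * iexp (2 * pi * (r *\<^sub>R g \<bullet> y)))"
      by (simp only: cnj_fourier integral_mult_right_zero integral_mult_left_zero) (simp add: fourier_measure_alt)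
    also have "\<dots> = (LINT p|(\<nu> \<Otimes>\<^sub>M \<nu>). iexp (- 2 * pi * (r *\<^sub>R g \<bullet> fst p)) * iexp (2 * pi * (r *\<^sub>R g \<bullet> snd p)))"
      by (subst \<nu>\<nu>.integral_fst'[symmetric])
         (auto intro!: \<nu>2.integrable_const_bound[where B = 1] simp: norm_mult)
    also have "\<dots> = (LINT p|(\<nu> \<Otimes>\<^sub>M \<nu>). iexp (g \<bullet> ((2 * pi * r) *\<^sub>R (snd p - fst p))))"
      by (intro Bochner_Integration.integral_cong)
         (auto simp: exp_add[symmetric] inner_diff_right algebra_simps)
    finally show ?thesis .
  qed
  have "of_real (LINT g|(?N \<Otimes>\<^sub>M ?N). (cmod (fourier_measure \<nu> (r *\<^sub>R g)))\<^sup>2)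
      = (LINT g|(?N \<Otimes>\<^sub>M ?N). LINT p|(\<nu> \<Otimes>\<^sub>M \<nu>). iexp (g \<bullet> ((2 * pi * r) *\<^sub>R (snd p - fst p))))"
    by (simp only: sq integral_complex_of_real[symmetric])
  also have "\<dots> = (LINT p|(\<nu> \<Otimes>\<^sub>M \<nu>). LINT g|(?N \<Otimes>\<^sub>M ?N). iexp (g \<bullet> ((2 * pi * r) *\<^sub>R (snd p - fst p))))"
  proof (intro Q.Fubini_integral[symmetric] Q.integrable_const_bound[where B = 1])
    have "(\<lambda>x. iexp (fst x \<bullet> ((2 * pi * r) *\<^sub>R (snd (snd x) - fst (snd x)))))
       \<in> borel_measurable ((borel \<Otimes>\<^sub>M borel) \<Otimes>\<^sub>M (borel \<Otimes>\<^sub>M borel) :: ((real \<times> real) \<times> ((real \<times> real) \<times> (real \<times> real))) measure)"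
      unfolding borel_prod by (intro borel_measurable_continuous_onI continuous_intros)
    then show "(\<lambda>(g, p). iexp (g \<bullet> ((2 * pi * r) *\<^sub>R (snd p - fst p))))
        \<in> borel_measurable ((?N \<Otimes>\<^sub>M ?N) \<Otimes>\<^sub>M (\<nu> \<Otimes>\<^sub>M \<nu>))"
      by (simp add: case_prod_unfold cong: measurable_cong_sets sets_pair_measure_cong)
  qed (auto simp: case_prod_unfold)
  also have "\<dots> = (LINT p|(\<nu> \<Otimes>\<^sub>M \<nu>). of_real (exp (- (2 * pi * r * dist (fst p) (snd p))\<^sup>2 / 2)))"
    by (simp only: char_std_normal_pair norm_scaleR dist_norm norm_minus_commute
         power_mult_distrib power2_abs) 
  finally show ?thesis
    by (simp only: integral_complex_of_real of_real_eq_iff)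
qed

lemma nn_integral_one_plus_abs_powr_finite:
  assumes "a > 1"
  shows "(\<integral>\<^sup>+t. ennreal ((1 + \<bar>t\<bar>) powr (- a)) \<partial>lborel) < \<infinity>"
proof -
  define h where "h t = ennreal ((1 + t) powr (- a)) * indicator {0..} t" for t :: real
  have [measurable]: "h \<in> borel_measurable borel" unfolding h_def by measurable
  have "(\<integral>\<^sup>+t. h t \<partial>lborel) = ennreal (0 - (1 + 0) powr (1 - a) / (1 - a))"
    unfolding h_def
  proof (rule nn_integral_FTC_atLeast)
    show "((\<lambda>t. (1 + t) powr (1 - a) / (1 - a)) \<longlongrightarrow> 0) at_top"
      using assms by real_asymp
    fix x :: real assume "0 \<le> x"
    then have "((\<lambda>t. (1 + t) powr (1 - a) / (1 - a)) has_real_derivative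
        ((1 - a) * (1 + x) powr (1 - a - 1) * 1) / (1 - a)) (at x)"
      by (intro DERIV_cdivide has_real_derivative_powr'[THEN DERIV_cong] derivative_eq_intros) auto
    then show "((\<lambda>t. (1 + t) powr (1 - a) / (1 - a)) has_real_derivative (1 + x) powr - a) (at x)"
      using assms by simp
  qed auto
  then have fin: "(\<integral>\<^sup>+t. h t \<partial>lborel) < \<infinity>" by simp
  have "(\<integral>\<^sup>+t. ennreal ((1 + \<bar>t\<bar>) powr (- a)) \<partial>lborel) \<le> (\<integral>\<^sup>+t. h t + h (0 + -1 * t) \<partial>lborel)"
    by (intro nn_integral_mono) (auto simp: h_def indicator_def)
  also have "\<dots> = (\<integral>\<^sup>+t. h t \<partial>lborel) + (\<integral>\<^sup>+t. h (0 + -1 * t) \<partial>lborel)"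
    by (intro nn_integral_add) auto
  also have "(\<integral>\<^sup>+t. h (0 + -1 * t) \<partial>lborel) = (\<integral>\<^sup>+t. h t \<partial>lborel)"
    using nn_integral_real_affine[of h "-1" 0] by simp
  finally show ?thesis
    using fin by (simp add: order.strict_trans1)
qed

text \<open>
  The Gaussian density is at most \<open>1\<close>, so rescaling the variables gains a factor \<open>1 / r\<close> in each
  of the two coordinates.
\<close>

lemma gaussian_mean_le_product_majorant:
  fixes F :: "real \<times> real \<Rightarrow> real" and \<psi> :: "real \<Rightarrow> ennreal"
  assumes [measurable]: "\<psi> \<in> borel_measurable borel"
    and F: "\<And>z. ennreal (F z) \<le> C * \<psi> (fst z) * \<psi> (snd z)" and r: "r > 0"
  shows "(\<integral>\<^sup>+g. ennreal (F (r *\<^sub>R g)) \<partial>(std_normal_distribution \<Otimes>\<^sub>M std_normal_distribution))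
    \<le> C * ((\<integral>\<^sup>+t. \<psi> t \<partial>lborel) / ennreal r)\<^sup>2"
proof -
  let ?N = std_normal_distribution
  interpret N: prob_space ?N
    by (rule prob_space_normal_density) simp
  have one: "(\<integral>\<^sup>+t. \<psi> (r * t) \<partial>?N) \<le> (\<integral>\<^sup>+t. \<psi> t \<partial>lborel) / ennreal r"
  proof -
    have "std_normal_density t \<le> 1" for t
    proof -
      have "1 / sqrt (2 * pi) * exp (- t\<^sup>2 / 2) \<le> 1 * 1"
        using pi_gt3 by (intro mult_mono) auto
      then show ?thesis by (simp add: std_normal_density_def)
    qed
    then have "(\<integral>\<^sup>+t. \<psi> (r * t) \<partial>?N) \<le> (\<integral>\<^sup>+t. 1 * \<psi> (r * t) \<partial>lborel)"
      by (subst nn_integral_density)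
         (auto intro!: nn_integral_mono mult_right_mono simp del: mult_1 simp: ennreal_le_1)
    also have "(\<integral>\<^sup>+t. 1 * \<psi> (r * t) \<partial>lborel) = (\<integral>\<^sup>+t. \<psi> t \<partial>lborel) / ennreal r"
      using nn_integral_real_affine[of \<psi> r 0] r
      by (simp add: mult.commute[of "ennreal r"] ennreal_mult_divide_eq)
    finally show ?thesis .
  qed
  have "(\<integral>\<^sup>+g. ennreal (F (r *\<^sub>R g)) \<partial>(?N \<Otimes>\<^sub>M ?N))
      \<le> (\<integral>\<^sup>+g. C * \<psi> (r * fst g) * \<psi> (r * snd g) \<partial>(?N \<Otimes>\<^sub>M ?N))"
    using F[of "r *\<^sub>R g" for g] by (intro nn_integral_mono) simp
  also have "\<dots> = (\<integral>\<^sup>+x. \<integral>\<^sup>+y. C * \<psi> (r * x) * \<psi> (r * y) \<partial>?N \<partial>?N)"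
    by (subst N.nn_integral_fst[symmetric]) auto
  also have "\<dots> = C * (\<integral>\<^sup>+t. \<psi> (r * t) \<partial>?N)\<^sup>2"
    by (simp add: nn_integral_cmult nn_integral_multc power2_eq_square mult_ac)
  also have "\<dots> \<le> C * ((\<integral>\<^sup>+t. \<psi> t \<partial>lborel) / ennreal r)\<^sup>2"
    by (intro mult_left_mono power_mono one) auto
  finally show ?thesis .
qed

text \<open>
  The hypothesis is a form of square integrability: the majorant is integrable because \<open>a > 1\<close>.
  The exponent \<open>2\<close> of \<open>\<epsilon>\<close> is the dimension of the plane, and this is what makes the powers of
  \<open>\<epsilon>\<close> cancel against the volume of a ball in the Cauchy-Schwarz argument.
\<close>

lemma near_diagonal_mass_le:
  fixes \<nu> :: "(real \<times> real) measure"
  assumes fin: "finite_measure \<nu>" and sets [measurable_cong]: "sets \<nu> = sets borel"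
    and C: "\<And>z. (cmod (fourier_measure \<nu> z))\<^sup>2
      \<le> C * ((1 + \<bar>fst z\<bar>) powr (- a) * (1 + \<bar>snd z\<bar>) powr (- a))"
    and "C \<ge> 0" "a > 1"
  shows "\<exists>C'. \<forall>\<epsilon>>0. measure (\<nu> \<Otimes>\<^sub>M \<nu>) {p. dist (fst p) (snd p) \<le> 2 * \<epsilon>} \<le> C' * \<epsilon>\<^sup>2"
proof -
  let ?N = std_normal_distribution
  interpret N: prob_space ?N
    by (rule prob_space_normal_density) simp
  interpret NN: pair_prob_space ?N ?N ..
  interpret \<nu>: finite_measure \<nu> by fact
  interpret \<nu>2: finite_measure "\<nu> \<Otimes>\<^sub>M \<nu>"
    by (intro finite_measure_pair_measure) (fact assms)+
  note [measurable] = measurable_fourier_measure[OF fin sets]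
  define J where "J = enn2real (\<integral>\<^sup>+t. ennreal ((1 + \<bar>t\<bar>) powr (- a)) \<partial>lborel)"
  have J: "(\<integral>\<^sup>+t. ennreal ((1 + \<bar>t\<bar>) powr (- a)) \<partial>lborel) = ennreal J" "J \<ge> 0"
    using nn_integral_one_plus_abs_powr_finite[OF \<open>a > 1\<close>] by (auto simp: J_def)
  have "measure (\<nu> \<Otimes>\<^sub>M \<nu>) {p. dist (fst p) (snd p) \<le> 2 * \<epsilon>} \<le> exp (1/2) * C * (4 * pi * J)\<^sup>2 * \<epsilon>\<^sup>2"
    if "\<epsilon> > 0" for \<epsilon>
  proof -
    \<comment> \<open>With this scale the Gaussian kernel is at least \<open>exp (- 1 / 2)\<close> at distance \<open>2 * \<epsilon>\<close>.\<close>
    define r where "r = 1 / (4 * pi * \<epsilon>)"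
    have r: "r > 0" using that by (simp add: r_def)
    define D where "D = {p :: (real \<times> real) \<times> (real \<times> real). dist (fst p) (snd p) \<le> 2 * \<epsilon>}"
    have sp: "space \<nu> = UNIV" using sets_eq_imp_space_eq[OF sets] by simp
    have Dm [measurable]: "D \<in> sets (\<nu> \<Otimes>\<^sub>M \<nu>)"
    proof -
      have "{p \<in> space (\<nu> \<Otimes>\<^sub>M \<nu>). dist (fst p) (snd p) \<le> 2 * \<epsilon>} \<in> sets (\<nu> \<Otimes>\<^sub>M \<nu>)"
        by measurable
      then show ?thesis by (simp add: D_def space_pair_measure sp)
    qed
    have "measure (\<nu> \<Otimes>\<^sub>M \<nu>) D = (LINT p|(\<nu> \<Otimes>\<^sub>M \<nu>). indicator D p)"
      using Dm by simp
    also have "\<dots> \<le> (LINT p|(\<nu> \<Otimes>\<^sub>M \<nu>). exp (1/2) * exp (- (2 * pi * r * dist (fst p) (snd p))\<^sup>2 / 2))"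
    proof (rule integral_mono)
      fix p :: "(real \<times> real) \<times> (real \<times> real)"
      have "1 \<le> exp (1/2) * exp (- (2 * pi * r * dist (fst p) (snd p))\<^sup>2 / 2)" if "p \<in> D"
      proof -
        have "2 * pi * r * dist (fst p) (snd p) \<le> 1"
          using that \<open>\<epsilon> > 0\<close> by (simp add: D_def r_def field_simps)
        then have "(2 * pi * r * dist (fst p) (snd p))\<^sup>2 \<le> 1"
          using r by (intro power_le_one) auto
        then show ?thesis by (simp add: exp_add[symmetric])
      qed
      then show "indicator D p \<le> exp (1/2) * exp (- (2 * pi * r * dist (fst p) (snd p))\<^sup>2 / 2)"
        by (auto simp: indicator_def)
    next
      show "integrable (\<nu> \<Otimes>\<^sub>M \<nu>) (\<lambda>p. exp (1/2) * exp (- (2 * pi * r * dist (fst p) (snd p))\<^sup>2 / 2))"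
        by (intro integrable_mult_right \<nu>2.integrable_const_bound[where B = 1]) auto
    qed (use Dm in \<open>auto simp: less_top[symmetric]\<close>)
    also have "\<dots> = exp (1/2) * (LINT g|(?N \<Otimes>\<^sub>M ?N). (cmod (fourier_measure \<nu> (r *\<^sub>R g)))\<^sup>2)"
      by (simp add: gaussian_energy_identity[OF fin sets])
    also have "(LINT g|(?N \<Otimes>\<^sub>M ?N). (cmod (fourier_measure \<nu> (r *\<^sub>R g)))\<^sup>2) \<le> C * (J / r)\<^sup>2"
    proof -
      have [measurable]: "(\<lambda>g. (cmod (fourier_measure \<nu> (r *\<^sub>R g)))\<^sup>2) \<in> borel_measurable (?N \<Otimes>\<^sub>M ?N)"
      proof -
        have "(\<lambda>g. (cmod (fourier_measure \<nu> (r *\<^sub>R g)))\<^sup>2) \<in> borel_measurable (borel \<Otimes>\<^sub>M borel)"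
          unfolding borel_prod by measurable
        then show ?thesis
          by (simp cong: measurable_cong_sets sets_pair_measure_cong)
      qed
      have "(\<integral>\<^sup>+g. ennreal ((cmod (fourier_measure \<nu> (r *\<^sub>R g)))\<^sup>2) \<partial>(?N \<Otimes>\<^sub>M ?N))
          \<le> ennreal C * ((\<integral>\<^sup>+t. ennreal ((1 + \<bar>t\<bar>) powr (- a)) \<partial>lborel) / ennreal r)\<^sup>2"
        using C \<open>C \<ge> 0\<close> r
        by (intro gaussian_mean_le_product_majorant) (auto simp: ennreal_mult[symmetric] mult_ac ennreal_leI)
      also have "\<dots> = ennreal (C * (J / r)\<^sup>2)"
        using J r \<open>C \<ge> 0\<close> by (simp add: divide_ennreal ennreal_mult ennreal_power)
      finally have "(\<integral>\<^sup>+g. ennreal ((cmod (fourier_measure \<nu> (r *\<^sub>R g)))\<^sup>2) \<partial>(?N \<Otimes>\<^sub>M ?N)) \<le> ennreal (C * (J / r)\<^sup>2)" .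
      then have "enn2real (\<integral>\<^sup>+g. ennreal ((cmod (fourier_measure \<nu> (r *\<^sub>R g)))\<^sup>2) \<partial>(?N \<Otimes>\<^sub>M ?N)) \<le> C * (J / r)\<^sup>2"
        using \<open>C \<ge> 0\<close> by (intro enn2real_leI) auto
      then show ?thesis
        by (subst integral_eq_nn_integral) auto
    qed
    also have "exp (1/2) * (C * (J / r)\<^sup>2) = exp (1/2) * C * (4 * pi * J)\<^sup>2 * \<epsilon>\<^sup>2"
      by (simp add: r_def power_mult_distrib mult_ac)
    finally show ?thesis by (simp add: D_def)
  qed
  then show ?thesis by blast
qed

lemma emeasure_eq_0_if_fourier_square_integrable:
  fixes \<nu> :: "(real \<times> real) measure"
  assumes fin: "finite_measure \<nu>" and sets [measurable_cong]: "sets \<nu> = sets borel"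
    and C: "\<And>z. (cmod (fourier_measure \<nu> z))\<^sup>2
      \<le> C * ((1 + \<bar>fst z\<bar>) powr (- a) * (1 + \<bar>snd z\<bar>) powr (- a))"
    and "C \<ge> 0" "a > 1"
    and P: "compact P" "emeasure lborel P = 0"
  shows "emeasure \<nu> P = 0"
proof -
  interpret \<nu>: finite_measure \<nu> by fact
  interpret \<nu>2: finite_measure "\<nu> \<Otimes>\<^sub>M \<nu>"
    by (intro finite_measure_pair_measure) (fact assms)+
  obtain C' where C': "\<And>\<epsilon>. \<epsilon> > 0 \<Longrightarrow>
      measure (\<nu> \<Otimes>\<^sub>M \<nu>) {p. dist (fst p) (snd p) \<le> 2 * \<epsilon>} \<le> C' * \<epsilon>\<^sup>2"
    using near_diagonal_mass_le[OF assms(1-5)] by blast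
  have Pb [measurable]: "P \<in> sets borel" using P by (simp add: borel_closed compact_imp_closed)
  have le: "pi * (measure \<nu> P)\<^sup>2 \<le> \<delta> * C'" if "\<delta> > 0" for \<delta>
  proof -
    obtain U where U: "open U" "P \<subseteq> U" "emeasure lborel U < ennreal \<delta>"
    proof (rule outer_regular_lborel[of P \<delta>])
      fix U assume "open U" "P \<subseteq> U" "emeasure lborel (U - P) < ennreal \<delta>"
      moreover have "emeasure lborel U = emeasure lborel (U - P)"
        using P \<open>open U\<close> by (intro emeasure_Diff_null_set[symmetric]) auto
      ultimately show ?thesis using that by auto
    qed (use \<open>\<delta> > 0\<close> in auto)
    obtain \<epsilon> where \<epsilon>: "\<epsilon> > 0" "(\<Union>x\<in>P. cball x \<epsilon>) \<subseteq> U"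
      using compact_subset_open_imp_cball_epsilon_subset[OF P(1) U(1,2)] by blast
    have "(emeasure \<nu> P)\<^sup>2 * emeasure lborel (cball (0 :: real \<times> real) \<epsilon>)
      \<le> emeasure lborel U * emeasure (\<nu> \<Otimes>\<^sub>M \<nu>) {p. dist (fst p) (snd p) \<le> 2 * \<epsilon>}"
      using U \<epsilon> by (intro Cauchy_Schwarz_cball_energy fin sets) auto
    also have "\<dots> \<le> ennreal \<delta> * ennreal (C' * \<epsilon>\<^sup>2)"
      using C'[OF \<epsilon>(1)] U by (intro mult_mono) (auto simp: \<nu>2.emeasure_eq_measure intro!: ennreal_leI)
    finally have "ennreal ((measure \<nu> P)\<^sup>2 * (pi * \<epsilon>\<^sup>2)) \<le> ennreal (\<delta> * (C' * \<epsilon>\<^sup>2))"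
      using \<epsilon> that
      by (simp add: \<nu>.emeasure_eq_measure emeasure_cball unit_ball_vol_2 ennreal_power ennreal_mult' ennreal_mult''
          power2_eq_square)
    moreover have "0 \<le> C' * \<epsilon>\<^sup>2"
      using C'[OF \<epsilon>(1)] by (rule order_trans[rotated]) simp
    ultimately have "(measure \<nu> P)\<^sup>2 * (pi * \<epsilon>\<^sup>2) \<le> \<delta> * (C' * \<epsilon>\<^sup>2)"
      using that by (subst (asm) ennreal_le_iff) auto
    then show ?thesis using \<epsilon> by (simp add: field_simps)
  qed
  have "pi * (measure \<nu> P)\<^sup>2 \<le> 0"
  proof (rule tendsto_lowerbound)
    show "((\<lambda>\<delta>. \<delta> * C') \<longlongrightarrow> 0) (at_right 0)"
      by (auto intro!: tendsto_eq_intros)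
    show "\<forall>\<^sub>F \<delta> in at_right 0. pi * (measure \<nu> P)\<^sup>2 \<le> \<delta> * C'"
      using le by (auto simp: eventually_at_right_field intro!: exI[of _ 1])
  qed simp
  then have "measure \<nu> P = 0" using pi_gt_zero by (auto simp: mult_le_0_iff simp del: pi_gt_zero)
  then show ?thesis by (simp add: \<nu>.emeasure_eq_measure)
qed

text \<open>
  The radial majorant \<open>norm z powr (- s)\<close> is replaced by a product of functions of the two
  coordinates, since \<open>(1 + \<bar>x\<bar>) * (1 + \<bar>y\<bar>)\<close> is at most four times the larger of \<open>1\<close>
  and \<open>(norm (x, y))\<^sup>2\<close>. The integral of the majorant then splits into one-dimensional ones.
\<close>

lemma emeasure_eq_0_if_fourier_decay:
  fixes \<nu> :: "(real \<times> real) measure"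
  assumes fin: "finite_measure \<nu>" and sets: "sets \<nu> = sets borel"
    and decay: "\<And>z. z \<noteq> 0 \<Longrightarrow> cmod (fourier_measure \<nu> z) \<le> c * norm z powr (- s / 2)" and "s > 2"
    and P: "compact P" "emeasure lborel P = 0"
  shows "emeasure \<nu> P = 0"
proof (rule emeasure_eq_0_if_fourier_square_integrable[OF fin sets _ _ _ P])
  define V where "V = measure \<nu> (space \<nu>)"
  define a where "a = s / 2"
  show "0 \<le> (c\<^sup>2 + V\<^sup>2) * 4 powr a" by simp
  show "1 < a" using \<open>s > 2\<close> by (simp add: a_def)
  fix z :: "real \<times> real"
  define p where "p = (1 + \<bar>fst z\<bar>) * (1 + \<bar>snd z\<bar>)"
  have p0: "p > 0" by (auto simp: p_def intro!: mult_pos_pos)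
  have nz: "\<bar>fst z\<bar> \<le> norm z" "\<bar>snd z\<bar> \<le> norm z"
    using norm_fst_le[of "fst z" "snd z"] norm_snd_le[of "snd z" "fst z"] by auto
  have "(cmod (fourier_measure \<nu> z))\<^sup>2 \<le> (c\<^sup>2 + V\<^sup>2) * (4 powr a * p powr (- a))"
  proof (cases "norm z \<ge> 1")
    case True
    have "p \<le> (2 * norm z) * (2 * norm z)"
      unfolding p_def using True nz by (intro mult_mono) auto
    then have "p / 4 \<le> (norm z)\<^sup>2" by (simp add: power2_eq_square)
    then have "((norm z)\<^sup>2) powr (- a) \<le> (p / 4) powr (- a)"
      using p0 \<open>1 < a\<close> by (intro powr_mono2') auto
    also have "\<dots> = 4 powr a * p powr (- a)"
      using p0 by (simp add: powr_divide powr_minus field_simps)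
    finally have le: "((norm z)\<^sup>2) powr (- a) \<le> 4 powr a * p powr (- a)" .
    have "(cmod (fourier_measure \<nu> z))\<^sup>2 \<le> (c * norm z powr (- s / 2))\<^sup>2"
      using True by (intro power_mono decay) auto
    also have "\<dots> = c\<^sup>2 * ((norm z)\<^sup>2) powr (- a)"
    proof -
      have "(norm z powr (- s / 2))\<^sup>2 = ((norm z)\<^sup>2) powr (- a)"
        using True by (simp add: power2_eq_square powr_mult a_def)
      then show ?thesis by (simp add: power_mult_distrib)
    qed
    also have "\<dots> \<le> (c\<^sup>2 + V\<^sup>2) * (4 powr a * p powr (- a))"
      by (intro mult_mono le) auto
    finally show ?thesis .
  next
    case False
    have "p \<le> 2 * 2"
      unfolding p_def using False nz by (intro mult_mono) auto
    then have "1 \<le> (p / 4) powr (- a)"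
      using p0 \<open>1 < a\<close> powr_mono2'[of "-a" "p/4" 1] by simp
    also have "\<dots> = 4 powr a * p powr (- a)"
      using p0 by (simp add: powr_divide powr_minus field_simps)
    finally have le: "1 \<le> 4 powr a * p powr (- a)" .
    have "(cmod (fourier_measure \<nu> z))\<^sup>2 \<le> V\<^sup>2"
      unfolding V_def by (intro power_mono norm_fourier_measure_le fin) auto
    also have "\<dots> \<le> (c\<^sup>2 + V\<^sup>2) * 1" by simp
    also have "\<dots> \<le> (c\<^sup>2 + V\<^sup>2) * (4 powr a * p powr (- a))"
      by (intro mult_left_mono le) auto
    finally show ?thesis .
  qed
  then show "(cmod (fourier_measure \<nu> z))\<^sup>2 \<le> (c\<^sup>2 + V\<^sup>2) * 4 powr a * ((1 + \<bar>fst z\<bar>) powr (- a) * (1 + \<bar>snd z\<bar>) powr (- a))"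
    unfolding p_def by (simp add: powr_mult mult_ac)
qed

section \<open>Fourier decay of a measure on the Kakeya set\<close>

definition unif :: "real measure" where
  "unif = density lborel (\<lambda>x. ennreal (indicator {0..1} x))"

lemma sets_unif [measurable_cong, simp]: "sets unif = sets borel"
  by (simp add: unif_def)

lemma prob_space_unif: "prob_space unif"
  by (rule prob_spaceI) (simp add: unif_def emeasure_density ennreal_indicator)

interpretation unif: prob_space unif
  by (rule prob_space_unif)

lemma integral_unif:
  fixes f :: "real \<Rightarrow> 'a::{banach, second_countable_topology}"
  assumes [measurable]: "f \<in> borel_measurable borel"
  shows "(LINT x|unif. f x) = (LINT x|lborel. indicator {0..1} x *\<^sub>R f x)"
  unfolding unif_def by (subst integral_density) auto

text \<open>
  Coordinates are clamped to \<open>[0, 1]\<close> so that the random points lie in the Kakeya set everywhere,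
  and not merely almost everywhere with respect to the uniform distribution.
\<close>

definition unit_clamp :: "real \<Rightarrow> real" where
  "unit_clamp x = max 0 (min 1 x)"

lemma unit_clamp_bounds: "0 \<le> unit_clamp x" "unit_clamp x \<le> 1"
  by (auto simp: unit_clamp_def)

lemma unit_clamp_eq: "x \<in> {0..1} \<Longrightarrow> unit_clamp x = x"
  by (auto simp: unit_clamp_def)

lemma measurable_unit_clamp [measurable]: "unit_clamp \<in> borel_measurable borel"
  unfolding unit_clamp_def by measurable

definition interval_transform :: "real \<Rightarrow> complex" where
  "interval_transform u = (LINT x|unif. iexp (- 2 * pi * u * unit_clamp x))"

lemma measurable_interval_transform [measurable]: "interval_transform \<in> borel_measurable borel"
  unfolding interval_transform_def[abs_def] by measurable

lemma norm_interval_transform_le_1: "cmod (interval_transform u) \<le> 1"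
proof -
  have "cmod (interval_transform u) \<le> (LINT x|unif. cmod (iexp (- 2 * pi * u * unit_clamp x)))"
    unfolding interval_transform_def by (rule integral_norm_bound)
  then show ?thesis by (simp add: unif.prob_space)
qed

lemma norm_interval_transform_le: "\<bar>u\<bar> * cmod (interval_transform u) \<le> 1 / pi"
proof (cases "u = 0")
  case False
  define c where "c = - 2 * of_real pi * \<i> * of_real u"
  have c: "c \<noteq> 0" using False by (simp add: c_def)
  have nc: "cmod c = 2 * pi * \<bar>u\<bar>" by (simp add: c_def norm_mult)
  have "interval_transform u = (LINT x|lborel. indicator {0..1} x *\<^sub>R exp (c * of_real x))"
    unfolding interval_transform_def
    by (subst integral_unif)
       (auto intro!: Bochner_Integration.integral_cong simp: indicator_def unit_clamp_eq c_def mult_ac)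
  also have "\<dots> = exp (c * of_real 1) / c - exp (c * of_real 0) / c"
  proof (rule integral_FTC_Icc)
    fix x :: real
    show "((\<lambda>x. exp (c * of_real x) / c) has_vector_derivative exp (c * of_real x)) (at x within {0..1})"
      using c by (auto intro!: derivative_eq_intros has_vector_derivative_real_field)
  qed (auto intro!: continuous_intros)
  finally have "cmod (interval_transform u) \<le> cmod (exp (c * of_real 1) / c) + cmod (exp (c * of_real 0) / c)"
    by (simp only: norm_triangle_ineq4)
  also have "\<dots> = 2 / cmod c"
    by (simp add: norm_divide c_def)
  finally show ?thesis using False by (simp add: nc field_simps)
qed simp

lemma norm_interval_transform_sq_le: "(cmod (interval_transform u))\<^sup>2 \<le> 2 / (1 + u\<^sup>2)"
proof -
  have "(cmod (interval_transform u))\<^sup>2 \<le> 1"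
    using norm_interval_transform_le_1 by (intro power_le_one) auto
  moreover have "(\<bar>u\<bar> * cmod (interval_transform u))\<^sup>2 \<le> 1"
  proof (rule power_le_one)
    have "1 / pi \<le> 1" using pi_gt3 by simp
    then show "\<bar>u\<bar> * cmod (interval_transform u) \<le> 1"
      using norm_interval_transform_le[of u] by linarith
  qed auto
  ultimately have "(1 + u\<^sup>2) * (cmod (interval_transform u))\<^sup>2 \<le> 2"
    by (simp add: algebra_simps power_mult_distrib)
  then show ?thesis
    by (simp add: pos_le_divide_eq add_pos_nonneg mult.commute)
qed

lemma norm_interval_transform_sq_le_1: "(cmod (interval_transform u))\<^sup>2 \<le> 1"
  by (intro power_le_one norm_interval_transform_le_1) simp

lemma integrable_norm_sq:
  "integrable unif (\<lambda>m. (cmod (interval_transform (\<alpha> + \<eta> * unit_clamp m)))\<^sup>2)"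
  by (intro unif.integrable_const_bound[where B = 1])
     (auto simp: power_le_one norm_interval_transform_le_1)

text \<open>
  The function \<open>2 / (1 + u\<^sup>2)\<close> has total integral \<open>2 * pi\<close>, and \<open>u\<close> moves with speed \<open>\<eta>\<close>.
\<close>

lemma integral_unif_norm_sq_le_slope:
  "\<bar>\<eta>\<bar> * (LINT m|unif. (cmod (interval_transform (\<alpha> + \<eta> * unit_clamp m)))\<^sup>2) \<le> 2 * pi"
proof (cases "\<eta> = 0")
  case False
  have "(LINT m|unif. (cmod (interval_transform (\<alpha> + \<eta> * unit_clamp m)))\<^sup>2)
      \<le> (LINT m|unif. 2 / (1 + (\<alpha> + \<eta> * unit_clamp m)\<^sup>2))"
  proof (rule integral_mono)
    have "1 \<le> 1 + (\<alpha> + \<eta> * unit_clamp m)\<^sup>2" for m by simp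
    then have "2 / (1 + (\<alpha> + \<eta> * unit_clamp m)\<^sup>2) \<le> 2 / 1" for m
      by (intro divide_left_mono) (auto simp: add_pos_nonneg)
    then show "integrable unif (\<lambda>m. 2 / (1 + (\<alpha> + \<eta> * unit_clamp m)\<^sup>2))"
      by (intro unif.integrable_const_bound[where B = 2]) auto
    show "integrable unif (\<lambda>m. (cmod (interval_transform (\<alpha> + \<eta> * unit_clamp m)))\<^sup>2)"
      by (rule integrable_norm_sq)
  qed (rule norm_interval_transform_sq_le)
  also have "\<dots> = (LINT m|lborel. indicator {0..1} m *\<^sub>R (2 / (1 + (\<alpha> + \<eta> * m)\<^sup>2)))"
    by (subst integral_unif) (auto intro!: Bochner_Integration.integral_cong simp: indicator_def unit_clamp_eq)
  also have "\<dots> = 2 / \<eta> * arctan (\<alpha> + \<eta> * 1) - 2 / \<eta> * arctan (\<alpha> + \<eta> * 0)"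
  proof (rule integral_FTC_Icc)
    fix m :: real
    have "((\<lambda>m. 2 / \<eta> * arctan (\<alpha> + \<eta> * m)) has_real_derivative 2 / (1 + (\<alpha> + \<eta> * m)\<^sup>2)) (at m within {0..1})"
    proof (rule DERIV_cong)
      show "((\<lambda>m. 2 / \<eta> * arctan (\<alpha> + \<eta> * m)) has_real_derivative
          2 / \<eta> * (inverse (1 + (\<alpha> + \<eta> * m)\<^sup>2) * \<eta>)) (at m within {0..1})"
        by (auto intro!: derivative_eq_intros)
    qed (use False in \<open>simp add: divide_inverse\<close>)
    then show "((\<lambda>m. 2 / \<eta> * arctan (\<alpha> + \<eta> * m)) has_vector_derivative 2 / (1 + (\<alpha> + \<eta> * m)\<^sup>2)) (at m within {0..1})"
      by (rule has_real_derivative_iff_has_vector_derivative[THEN iffD1])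
  next
    have nz: "1 + (\<alpha> + \<eta> * m)\<^sup>2 \<noteq> 0" for m by (smt (verit) zero_le_power2)
    show "continuous_on {0..1} (\<lambda>m. 2 / (1 + (\<alpha> + \<eta> * m)\<^sup>2))"
      using nz by (auto intro!: continuous_intros)
  qed simp
  also have "\<dots> \<le> 2 / \<bar>\<eta>\<bar> * pi"
  proof -
    have "\<bar>arctan (\<alpha> + \<eta> * 1) - arctan (\<alpha> + \<eta> * 0)\<bar> \<le> pi"
      using arctan_bounded[of "\<alpha> + \<eta> * 1"] arctan_bounded[of "\<alpha> + \<eta> * 0"] by linarith
    then have "\<bar>2 / \<eta>\<bar> * \<bar>arctan (\<alpha> + \<eta> * 1) - arctan (\<alpha> + \<eta> * 0)\<bar> \<le> \<bar>2 / \<eta>\<bar> * pi"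
      by (intro mult_left_mono) auto
    then have "\<bar>2 / \<eta> * arctan (\<alpha> + \<eta> * 1) - 2 / \<eta> * arctan (\<alpha> + \<eta> * 0)\<bar> \<le> \<bar>2 / \<eta>\<bar> * pi"
      unfolding abs_mult[symmetric] right_diff_distrib .
    then show ?thesis by (simp add: abs_divide)
  qed
  finally show ?thesis using False by (simp add: field_simps)
qed simp

text \<open>
  If \<open>\<xi>\<close> dominates, no slope makes the frequency along the segment small, and the pointwise decay
  of the transform is enough.
\<close>

lemma integral_unif_norm_sq_le_steep:
  assumes "4 * \<bar>\<eta>\<bar> \<le> \<bar>\<xi>\<bar>"
  shows "\<bar>\<xi>\<bar> * (LINT m|unif. (cmod (interval_transform ((\<xi> - 2 * \<eta>) / 2 + \<eta> * unit_clamp m)))\<^sup>2) \<le> 2"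
proof -
  have "\<bar>\<xi>\<bar> * (LINT m|unif. (cmod (interval_transform ((\<xi> - 2 * \<eta>) / 2 + \<eta> * unit_clamp m)))\<^sup>2)
    = (LINT m|unif. \<bar>\<xi>\<bar> * (cmod (interval_transform ((\<xi> - 2 * \<eta>) / 2 + \<eta> * unit_clamp m)))\<^sup>2)"
    by simp
  also have "\<dots> \<le> 2"
  proof (rule unif.integral_le_const)
    show "integrable unif (\<lambda>m. \<bar>\<xi>\<bar> * (cmod (interval_transform ((\<xi> - 2 * \<eta>) / 2 + \<eta> * unit_clamp m)))\<^sup>2)"
      by (intro integrable_mult_right integrable_norm_sq)
    have "\<bar>\<xi>\<bar> * (cmod (interval_transform ((\<xi> - 2 * \<eta>) / 2 + \<eta> * unit_clamp m)))\<^sup>2 \<le> 2" for m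
    proof -
      define w where "w = (\<xi> - 2 * \<eta>) / 2 + \<eta> * unit_clamp m"
      define J where "J = cmod (interval_transform w)"
      have J: "0 \<le> J" "J \<le> 1" "\<bar>w\<bar> * J \<le> 1 / pi"
        using norm_interval_transform_le_1 norm_interval_transform_le by (auto simp: J_def)
      have "\<bar>\<eta> * (1 - unit_clamp m)\<bar> \<le> \<bar>\<eta>\<bar> * 1"
        unfolding abs_mult using unit_clamp_bounds[of m] by (intro mult_left_mono) auto
      moreover have "w = \<xi> / 2 - \<eta> * (1 - unit_clamp m)"
        by (simp add: w_def field_simps)
      ultimately have "\<bar>\<xi>\<bar> / 4 \<le> \<bar>w\<bar>"
        using assms by linarith
      then have "\<bar>\<xi>\<bar> * J\<^sup>2 \<le> 4 * \<bar>w\<bar> * (J * 1)"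
        unfolding power2_eq_square using J by (intro mult_mono) auto
      also have "\<dots> \<le> 4 * (1 / pi)" using J by simp
      also have "\<dots> \<le> 2" using pi_gt3 by (simp add: field_simps)
      finally show ?thesis by (simp add: J_def w_def)
    qed
    then show "AE m in unif. \<bar>\<xi>\<bar> * (cmod (interval_transform ((\<xi> - 2 * \<eta>) / 2 + \<eta> * unit_clamp m)))\<^sup>2 \<le> 2"
      by simp
  qed
  finally show ?thesis .
qed

lemma integral_unif_norm_sq_le:
  fixes \<xi> \<eta> :: real
  defines "I \<equiv> (LINT m|unif. (cmod (interval_transform ((\<xi> - 2 * \<eta>) / 2 + \<eta> * unit_clamp m)))\<^sup>2)"
  shows "\<bar>\<xi>\<bar> * I \<le> 8 * pi" "\<bar>\<eta>\<bar> * I \<le> 8 * pi"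
proof -
  have I: "0 \<le> I" unfolding I_def by simp
  have \<eta>: "\<bar>\<eta>\<bar> * I \<le> 2 * pi" unfolding I_def by (rule integral_unif_norm_sq_le_slope)
  then show "\<bar>\<eta>\<bar> * I \<le> 8 * pi" using pi_gt3 by linarith
  show "\<bar>\<xi>\<bar> * I \<le> 8 * pi"
  proof (cases "4 * \<bar>\<eta>\<bar> \<le> \<bar>\<xi>\<bar>")
    case True
    then have "\<bar>\<xi>\<bar> * I \<le> 2" unfolding I_def by (rule integral_unif_norm_sq_le_steep)
    then show ?thesis using pi_gt3 by linarith
  next
    case False
    then have "\<bar>\<xi>\<bar> * I \<le> 4 * \<bar>\<eta>\<bar> * I" using I by (intro mult_right_mono) auto
    then show ?thesis using \<eta> by linarith
  qed
qed

text \<open>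
  The first parameter chooses the line; the mean of the other two is the position on it. The mean of
  two independent uniform variables is used because its Fourier transform is a square and hence
  decays quadratically. Halving the first parameter keeps the line parameter below \<open>1\<close>; slopes
  in \<open>[-2, 0]\<close> are enough for the decay.
\<close>

definition besicovitch_point :: "real \<times> real \<times> real \<Rightarrow> real \<times> real" where
  "besicovitch_point q = (let m = unit_clamp (fst q) / 2; x = (unit_clamp (fst (snd q)) + unit_clamp (snd (snd q))) / 2
     in (x, x * (4 * m - 2) + intercept m))"

lemma besicovitch_point_in: "besicovitch_point q \<in> besicovitch"
  unfolding besicovitch_point_def Let_def
  using unit_clamp_bounds[of "fst q"] unit_clamp_bounds[of "fst (snd q)"] unit_clamp_bounds[of "snd (snd q)"]
  by (intro line_in_besicovitch) auto

abbreviation "cube3 \<equiv> unif \<Otimes>\<^sub>M (unif \<Otimes>\<^sub>M unif)"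

lemma measurable_besicovitch_point [measurable]:
  "(\<lambda>q. fst (besicovitch_point q)) \<in> borel_measurable cube3"
  "(\<lambda>q. snd (besicovitch_point q)) \<in> borel_measurable cube3"
  unfolding besicovitch_point_def Let_def fst_conv snd_conv by measurable

definition plane_transform :: "real \<Rightarrow> real \<Rightarrow> complex" where
  "plane_transform \<xi> \<eta> = (LINT q|cube3.
     iexp (- 2 * pi * (\<xi> * fst (besicovitch_point q) + \<eta> * snd (besicovitch_point q))))"

text \<open>
  For a fixed line the intercept contributes a factor of modulus \<open>1\<close>, so the bound does not depend
  on where the lines are placed.
\<close>

lemma norm_plane_transform_le:
  "cmod (plane_transform \<xi> \<eta>)
    \<le> (LINT m|unif. (cmod (interval_transform ((\<xi> - 2 * \<eta>) / 2 + \<eta> * unit_clamp m)))\<^sup>2)"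
proof -
  interpret UU: pair_prob_space unif unif ..
  interpret UUU: pair_prob_space unif "unif \<Otimes>\<^sub>M unif" ..
  define w where "w m = (\<xi> - 2 * \<eta>) / 2 + \<eta> * unit_clamp m" for m
  define e where "e m s = iexp (- 2 * pi * w m * unit_clamp s)" for m s
  define d where "d m = iexp (- 2 * pi * (\<eta> * intercept (unit_clamp m / 2)))" for m
  have [measurable]: "w \<in> borel_measurable borel" "d \<in> borel_measurable borel"
    unfolding w_def[abs_def] d_def[abs_def] by measurable
  have [measurable]: "e m \<in> borel_measurable borel" for m
    unfolding e_def by measurable
  have "iexp (- 2 * pi * (\<xi> * fst (besicovitch_point q) + \<eta> * snd (besicovitch_point q)))
     = d (fst q) * (e (fst q) (fst (snd q)) * e (fst q) (snd (snd q)))" for q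
    unfolding d_def e_def exp_add[symmetric] w_def besicovitch_point_def Let_def
    by (rule arg_cong[where f = exp]) (simp add: field_simps)
  then have "plane_transform \<xi> \<eta> = (LINT q|cube3. d (fst q) * (e (fst q) (fst (snd q)) * e (fst q) (snd (snd q))))"
    by (simp add: plane_transform_def)
  also have "\<dots> = (LINT m|unif. LINT p|(unif \<Otimes>\<^sub>M unif). d m * (e m (fst p) * e m (snd p)))"
  proof (subst UUU.integral_fst'[symmetric])
    have [measurable]: "(\<lambda>q. e (fst q) (fst (snd q))) \<in> borel_measurable cube3"
      "(\<lambda>q. e (fst q) (snd (snd q))) \<in> borel_measurable cube3"
      unfolding e_def by measurable
    show "integrable cube3 (\<lambda>q. d (fst q) * (e (fst q) (fst (snd q)) * e (fst q) (snd (snd q))))"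
      by (intro UUU.integrable_const_bound[where B = 1]) (auto simp: norm_mult d_def e_def)
  qed simp
  also have "\<dots> = (LINT m|unif. d m * (interval_transform (w m) * interval_transform (w m)))"
  proof (intro Bochner_Integration.integral_cong refl)
    fix m
    have "(LINT p|(unif \<Otimes>\<^sub>M unif). e m (fst p) * e m (snd p))
        = (LINT s|unif. LINT t|unif. e m s * e m t)"
      by (subst UU.integral_fst'[symmetric])
         (auto intro!: UU.integrable_const_bound[where B = 1] simp: norm_mult e_def)
    also have "\<dots> = interval_transform (w m) * interval_transform (w m)"
      by (simp add: interval_transform_def e_def)
    finally show "(LINT p|(unif \<Otimes>\<^sub>M unif). d m * (e m (fst p) * e m (snd p)))
       = d m * (interval_transform (w m) * interval_transform (w m))"
      by simp
  qed
  also have "cmod \<dots> \<le> (LINT m|unif. cmod (d m * (interval_transform (w m) * interval_transform (w m))))"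
    by (rule integral_norm_bound)
  also have "\<dots> = (LINT m|unif. (cmod (interval_transform (w m)))\<^sup>2)"
    by (simp add: norm_mult d_def power2_eq_square)
  finally show ?thesis by (simp add: w_def)
qed

definition param_space :: "((real \<times> real \<times> real) \<times> ('n \<Rightarrow> real)) measure" where
  "param_space = cube3 \<Otimes>\<^sub>M PiM UNIV (\<lambda>_. unif)"

text \<open>
  The second parameter is indexed by the whole type, and not by the coordinates other than \<open>i\<close>
  and \<open>j\<close>, so that the parameter space is the same product measure for all \<open>i\<close> and \<open>j\<close>.
\<close>

definition kakeya_point :: "'n \<Rightarrow> 'n \<Rightarrow> (real \<times> real \<times> real) \<times> ('n \<Rightarrow> real) \<Rightarrow> real ^ 'n" where
  "kakeya_point i j p = (\<chi> k. if k = i then fst (besicovitch_point (fst p))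
     else if k = j then snd (besicovitch_point (fst p)) else unit_clamp (snd p k))"

definition kakeya_measure :: "'n::finite \<Rightarrow> 'n \<Rightarrow> (real ^ 'n) measure" where
  "kakeya_measure i j = distr param_space borel (kakeya_point i j)"

lemma measurable_kakeya_point [measurable]:
  "kakeya_point i (j::'n::finite) \<in> measurable param_space borel"
proof (subst borel_measurable_euclidean_space, intro ballI)
  fix b :: "real ^ 'n" assume "b \<in> Basis"
  then obtain k where b: "b = axis k 1" by (auto simp: Basis_vec_def)
  have "(\<lambda>p. kakeya_point i j p \<bullet> b) = (\<lambda>p. if k = i then fst (besicovitch_point (fst p))
     else if k = j then snd (besicovitch_point (fst p)) else unit_clamp (snd p k))"
    by (auto simp: b inner_axis kakeya_point_def)
  moreover have "\<dots> \<in> borel_measurable param_space"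
    unfolding param_space_def
    by (cases "k = i"; cases "k = j") (simp_all, measurable)
  ultimately show "(\<lambda>p. kakeya_point i j p \<bullet> b) \<in> borel_measurable param_space"
    by simp
qed

lemma prob_space_kakeya_measure: "prob_space (kakeya_measure i (j::'n::finite))"
proof -
  interpret UU: pair_prob_space unif unif ..
  interpret UUU: pair_prob_space unif "unif \<Otimes>\<^sub>M unif" ..
  interpret P: prob_space "PiM (UNIV :: 'n set) (\<lambda>_. unif)"
    by (intro prob_space_PiM prob_space_unif)
  interpret Q: pair_prob_space cube3 "PiM (UNIV :: 'n set) (\<lambda>_. unif)" ..
  have "prob_space (param_space :: ((real \<times> real \<times> real) \<times> ('n \<Rightarrow> real)) measure)"
    unfolding param_space_def by (rule Q.prob_space_axioms)
  then show ?thesis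
    unfolding kakeya_measure_def by (rule prob_space.prob_space_distr) simp
qed

lemma fourier_kakeya_measure:
  fixes z :: "real ^ 'n::finite"
  assumes "i \<noteq> j"
  shows "fourier_measure (kakeya_measure i j) z
    = plane_transform (z $ i) (z $ j) * (\<Prod>k\<in>UNIV - {i, j}. interval_transform (z $ k))"
proof -
  interpret UU: pair_prob_space unif unif ..
  interpret UUU: pair_prob_space unif "unif \<Otimes>\<^sub>M unif" ..
  interpret S: product_sigma_finite "\<lambda>_::'n. unif" ..
  interpret P: prob_space "PiM (UNIV :: 'n set) (\<lambda>_. unif)"
    by (intro prob_space_PiM prob_space_unif)
  interpret Q: pair_prob_space cube3 "PiM (UNIV :: 'n set) (\<lambda>_. unif)" ..
  define g where "g q = iexp (- 2 * pi * (z $ i * fst (besicovitch_point q) + z $ j * snd (besicovitch_point q)))" for q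
  define h where "h k x = (if k \<in> {i, j} then 1 else iexp (- 2 * pi * z $ k * unit_clamp x))" for k x
  have [measurable]: "h k \<in> borel_measurable borel" for k
    unfolding h_def by (cases "k \<in> {i, j}") simp_all
  have [measurable]: "g \<in> borel_measurable cube3"
    unfolding g_def[abs_def] by measurable
  have split: "iexp (- 2 * pi * (z \<bullet> kakeya_point i j p)) = g (fst p) * (\<Prod>k\<in>UNIV. h k (snd p k))" for p
  proof -
    have U: "(UNIV :: 'n set) = insert i (insert j (UNIV - {i, j}))" by auto
    have "z \<bullet> kakeya_point i j p = z $ i * fst (besicovitch_point (fst p)) + z $ j * snd (besicovitch_point (fst p))
        + (\<Sum>k\<in>UNIV - {i, j}. z $ k * unit_clamp (snd p k))"
      unfolding inner_vec_def
      by (subst U) (use assms in \<open>simp add: kakeya_point_def\<close>)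
    then have "iexp (- 2 * pi * (z \<bullet> kakeya_point i j p))
        = g (fst p) * exp (\<Sum>k\<in>UNIV - {i, j}. \<i> * of_real (- 2 * pi * z $ k * unit_clamp (snd p k)))"
      unfolding g_def exp_add[symmetric]
      by (intro arg_cong[where f = exp])
         (simp add: distrib_left right_diff_distrib sum_distrib_left mult_ac sum_negf)
    also have "exp (\<Sum>k\<in>UNIV - {i, j}. \<i> * of_real (- 2 * pi * z $ k * unit_clamp (snd p k)))
       = (\<Prod>k\<in>UNIV. h k (snd p k))"
      by (subst exp_sum) (auto intro!: prod.mono_neutral_cong_left simp: h_def split: if_split_asm)
    finally show ?thesis .
  qed
  have hk: "(LINT x|unif. h k x) = (if k \<in> {i, j} then 1 else interval_transform (z $ k))" for k
    by (simp add: h_def interval_transform_def unif.prob_space)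
  have hi: "integrable unif (h k)" for k
    by (intro unif.integrable_const_bound[where B = 1]) (auto simp: h_def)
  have "fourier_measure (kakeya_measure i j) z = (LINT p|param_space. g (fst p) * (\<Prod>k\<in>UNIV. h k (snd p k)))"
    unfolding fourier_measure_alt kakeya_measure_def split[symmetric]
    by (subst integral_distr) auto
  also have "\<dots> = (LINT q|cube3. LINT w|PiM UNIV (\<lambda>_. unif). g q * (\<Prod>k\<in>UNIV. h k (w k)))"
    unfolding param_space_def
  proof (subst Q.integral_fst'[symmetric])
    show "integrable (cube3 \<Otimes>\<^sub>M PiM UNIV (\<lambda>_. unif)) (\<lambda>p. g (fst p) * (\<Prod>k\<in>UNIV. h k (snd p k)))"
    proof (intro Q.integrable_const_bound[where B = 1] AE_I2)
      fix p
      have "cmod (h k x) = 1" for k x by (simp add: h_def)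
      then show "cmod (g (fst p) * (\<Prod>k\<in>UNIV. h k (snd p k))) \<le> 1"
        by (simp add: norm_mult g_def prod_norm[symmetric])
    qed measurable
  qed simp
  also have "\<dots> = (LINT q|cube3. g q) * (\<Prod>k\<in>UNIV. LINT x|unif. h k x)"
    using S.product_integral_prod[of UNIV h] hi by simp
  also have "(\<Prod>k\<in>UNIV. LINT x|unif. h k x) = (\<Prod>k\<in>UNIV - {i, j}. interval_transform (z $ k))"
    unfolding hk by (intro prod.mono_neutral_cong_right) auto
  finally show ?thesis by (simp add: plane_transform_def g_def)
qed

text \<open>
  Each factor of the transform is at most \<open>1\<close> in modulus, and one of them is \<open>O(1 / \<bar>z $ k\<bar>)\<close> for
  every coordinate \<open>k\<close>. Summing over \<open>k\<close> replaces the coordinates by the norm.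
\<close>

lemma fourier_kakeya_measure_decay:
  fixes z :: "real ^ 'n::finite"
  assumes "i \<noteq> j"
  shows "norm z * cmod (fourier_measure (kakeya_measure i j) z) \<le> CARD('n) * (8 * pi)"
proof -
  define A where "A = cmod (plane_transform (z $ i) (z $ j))"
  define J where "J k = cmod (interval_transform (z $ k))" for k
  have F: "cmod (fourier_measure (kakeya_measure i j) z) = A * (\<Prod>k\<in>UNIV - {i, j}. J k)"
    by (simp add: fourier_kakeya_measure[OF assms] norm_mult A_def J_def prod_norm)
  have J: "0 \<le> J k" "J k \<le> 1" "\<bar>z $ k\<bar> * J k \<le> 8 * pi" for k
  proof -
    show "0 \<le> J k" "J k \<le> 1" by (auto simp: J_def norm_interval_transform_le_1)
    have "1 / pi \<le> 1" "1 \<le> 8 * pi" using pi_gt3 by simp_all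
    then show "\<bar>z $ k\<bar> * J k \<le> 8 * pi"
      using norm_interval_transform_le[of "z $ k"] unfolding J_def by linarith
  qed
  define I where "I = (LINT m|unif. (cmod (interval_transform ((z $ i - 2 * z $ j) / 2 + z $ j * unit_clamp m)))\<^sup>2)"
  have AI: "A \<le> I"
    unfolding A_def I_def by (rule norm_plane_transform_le)
  have A: "0 \<le> A" "\<bar>z $ i\<bar> * A \<le> 8 * pi" "\<bar>z $ j\<bar> * A \<le> 8 * pi"
    using mult_left_mono[OF AI, of "\<bar>z $ i\<bar>"] mult_left_mono[OF AI, of "\<bar>z $ j\<bar>"]
      integral_unif_norm_sq_le[where \<xi> = "z $ i" and \<eta> = "z $ j", folded I_def]
    by (auto simp: A_def)
  have "I \<le> 1"
    unfolding I_def
    by (rule unif.integral_le_const[OF integrable_norm_sq])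
       (intro AE_I2 norm_interval_transform_sq_le_1)
  then have A1: "A \<le> 1" using AI by linarith
  have pk: "0 \<le> (\<Prod>k\<in>S. J k)" "(\<Prod>k\<in>S. J k) \<le> 1" for S
    by (intro prod_nonneg J) (intro prod_le_1 conjI J)
  have "\<bar>z $ k\<bar> * (A * (\<Prod>k\<in>UNIV - {i, j}. J k)) \<le> 8 * pi" for k
  proof (cases "k \<in> {i, j}")
    case True
    then have "\<bar>z $ k\<bar> * A \<le> 8 * pi"
      using A by auto
    then have "(\<bar>z $ k\<bar> * A) * (\<Prod>k\<in>UNIV - {i, j}. J k) \<le> (8 * pi) * 1"
      by (rule mult_mono) (simp_all add: pk)
    then show ?thesis by (simp add: mult_ac)
  next
    case False
    have "A * (\<Prod>k\<in>UNIV - {i, j} - {k}. J k) \<le> 1 * 1"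
      by (rule mult_mono) (simp_all add: A1 pk)
    with J(3)[of k] have "(\<bar>z $ k\<bar> * J k) * (A * (\<Prod>k\<in>UNIV - {i, j} - {k}. J k)) \<le> (8 * pi) * (1 * 1)"
      by (rule mult_mono) (simp_all add: A pk)
    moreover have "(\<Prod>k\<in>UNIV - {i, j}. J k) = J k * (\<Prod>k\<in>UNIV - {i, j} - {k}. J k)"
      using False by (intro prod.remove) auto
    ultimately show ?thesis by (simp add: mult_ac)
  qed
  then have "(\<Sum>k\<in>UNIV. \<bar>z $ k\<bar> * cmod (fourier_measure (kakeya_measure i j) z)) \<le> (\<Sum>k\<in>(UNIV::'n set). 8 * pi)"
    unfolding F by (intro sum_mono)
  then have "(\<Sum>k\<in>UNIV. \<bar>z $ k\<bar>) * cmod (fourier_measure (kakeya_measure i j) z) \<le> CARD('n) * (8 * pi)"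
    by (simp add: sum_distrib_right)
  then show ?thesis
    using mult_right_mono[OF norm_le_l1_cart[of z], of "cmod (fourier_measure (kakeya_measure i j) z)"]
    by simp
qed

section \<open>The cylinder over the planar set\<close>

text \<open>
  A point outside the support has a null open neighbourhood, and by the Lindeloef property countably
  many of these cover the complement.
\<close>

lemma emeasure_compl_eq_0_if_spt_subset:
  fixes \<mu> :: "'a::euclidean_space measure"
  assumes sets: "sets \<mu> = sets borel" and spt: "measure_spt \<mu> \<subseteq> K"
  shows "emeasure \<mu> (- K) = 0"
proof -
  define \<U> where "\<U> = {U. open U \<and> emeasure \<mu> U = 0}"
  have "\<Union>\<U> \<supseteq> - K"
  proof
    fix x assume "x \<in> - K"
    then have "x \<notin> measure_spt \<mu>" using spt by blast
    then obtain U where "open U" "x \<in> U" "\<not> emeasure \<mu> U > 0"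
      by (auto simp: measure_spt_def)
    then show "x \<in> \<Union>\<U>"
      by (auto simp: \<U>_def zero_less_iff_neq_zero)
  qed
  obtain \<V> where V: "\<V> \<subseteq> \<U>" "countable \<V>" "\<Union>\<V> = \<Union>\<U>"
    using Lindelof[of \<U>] by (auto simp: \<U>_def)
  have "(\<Union>U\<in>\<V>. U) \<in> null_sets \<mu>"
    using V(1,2) sets by (intro null_sets_UN') (auto simp: \<U>_def null_sets_def)
  then have "emeasure \<mu> (\<Union>\<V>) = 0" by auto
  moreover have "emeasure \<mu> (- K) \<le> emeasure \<mu> (\<Union>\<V>)"
    using V \<open>\<Union>\<U> \<supseteq> - K\<close> sets by (intro emeasure_mono) (auto simp: \<U>_def intro!: borel_open)
  ultimately show ?thesis by simp
qed

lemma measure_spt_subset_closed: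
  fixes \<mu> :: "'a::euclidean_space measure"
  assumes "closed K" "emeasure \<mu> (- K) = 0"
  shows "measure_spt \<mu> \<subseteq> K"
proof
  fix x assume x: "x \<in> measure_spt \<mu>"
  show "x \<in> K"
  proof (rule ccontr)
    assume "x \<notin> K"
    then have "emeasure \<mu> (- K) > 0"
      using x \<open>closed K\<close> by (auto simp: measure_spt_def open_Compl)
    then show False using assms by simp
  qed
qed

text \<open>
  The lines of the Besicovitch set cover the directions that are closer to the horizontal axis;
  its reflection in the diagonal covers the others.
\<close>

definition kakeya_base :: "(real \<times> real) set" where
  "kakeya_base = besicovitch \<union> prod.swap -` besicovitch"

lemma closed_kakeya_base: "closed kakeya_base"
  unfolding kakeya_base_def
  by (intro closed_Un closed_vimage compact_imp_closed compact_besicovitch continuous_on_swap)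

lemma compact_kakeya_base: "compact kakeya_base"
proof -
  have swap: "prod.swap -` besicovitch = prod.swap ` besicovitch"
    by force
  have "compact (prod.swap ` besicovitch)"
    by (intro compact_continuous_image continuous_on_swap compact_besicovitch)
  then show ?thesis
    unfolding kakeya_base_def swap by (rule compact_Un[OF compact_besicovitch])
qed

lemma emeasure_kakeya_base: "emeasure lborel kakeya_base = 0"
proof -
  have b: "besicovitch \<in> sets borel"
    by (intro borel_closed compact_imp_closed compact_besicovitch)
  have "emeasure lborel besicovitch
      = emeasure (distr (lborel \<Otimes>\<^sub>M lborel) (lborel \<Otimes>\<^sub>M lborel) (\<lambda>(x, y). (y, x))) besicovitch"
    by (subst lborel_pair.distr_pair_swap[symmetric]) (simp add: lborel_prod)
  also have "\<dots> = emeasure (lborel \<Otimes>\<^sub>M lborel) ((\<lambda>(x, y). (y, x)) -` besicovitch \<inter> space (lborel \<Otimes>\<^sub>M lborel))"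
    by (rule emeasure_distr[OF measurable_pair_swap']) (simp only: lborel_prod sets_lborel b)
  also have "(\<lambda>(x, y). (y, x)) -` besicovitch = prod.swap -` besicovitch"
    by auto
  also have "emeasure (lborel \<Otimes>\<^sub>M lborel) (prod.swap -` besicovitch \<inter> space (lborel \<Otimes>\<^sub>M lborel))
      = emeasure lborel (prod.swap -` besicovitch)"
    by (simp only: lborel_prod space_lborel space_borel Int_UNIV_right)
  finally have "emeasure lborel (prod.swap -` besicovitch) = 0"
    by (simp add: emeasure_besicovitch)
  moreover have "closed (prod.swap -` besicovitch)"
    by (intro closed_vimage compact_imp_closed[OF compact_besicovitch] continuous_on_swap)
  ultimately have "prod.swap -` besicovitch \<in> null_sets lborel"
    by (auto simp: null_sets_def)
  then show ?thesis
    unfolding kakeya_base_def using b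
    by (subst emeasure_Un_null_set) (auto simp: emeasure_besicovitch)
qed

lemma segment_in_kakeya_base:
  assumes "\<bar>u\<bar> \<le> 1" "\<bar>v\<bar> \<le> 1"
  shows "\<exists>a. \<forall>s\<in>{0..1}. a + s *\<^sub>R (u, v) \<in> kakeya_base"
proof (cases "\<bar>v\<bar> \<le> \<bar>u\<bar>")
  case True
  then show ?thesis
    using segment_in_besicovitch[of v u] assms by (auto simp: kakeya_base_def)
next
  case False
  then obtain a where a: "\<And>s. s \<in> {0..1} \<Longrightarrow> a + s *\<^sub>R (v, u) \<in> besicovitch"
    using segment_in_besicovitch[of u v] assms by (meson linear)
  have "prod.swap a + s *\<^sub>R (u, v) \<in> kakeya_base" if "s \<in> {0..1}" for s
    using a[OF that] by (cases a) (simp add: kakeya_base_def)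
  then show ?thesis by blast
qed

definition kakeya_cylinder :: "'n::finite \<Rightarrow> 'n \<Rightarrow> (real ^ 'n) set" where
  "kakeya_cylinder i j = {v. (v $ i, v $ j) \<in> kakeya_base \<and> (\<forall>k. k \<noteq> i \<and> k \<noteq> j \<longrightarrow> \<bar>v $ k\<bar> \<le> 1)}"

lemma closed_kakeya_cylinder: "closed (kakeya_cylinder i j)"
proof -
  have "closed ((\<lambda>v :: real ^ 'a. (v $ i, v $ j)) -` kakeya_base)"
    by (intro closed_vimage closed_kakeya_base continuous_intros)
  then have "closed {v :: real ^ 'a. (v $ i, v $ j) \<in> kakeya_base}"
    by (simp add: vimage_def)
  moreover have "closed {v :: real ^ 'a. \<forall>k. k \<noteq> i \<and> k \<noteq> j \<longrightarrow> \<bar>v $ k\<bar> \<le> 1}"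
    by (intro closed_Collect_all closed_Collect_imp closed_Collect_le continuous_intros) auto
  ultimately show ?thesis
    unfolding kakeya_cylinder_def by (rule closed_Collect_conj)
qed

lemma compact_kakeya_cylinder: "compact (kakeya_cylinder i j)"
proof -
  obtain B where B: "\<And>q. q \<in> kakeya_base \<Longrightarrow> norm q \<le> B"
    using compact_kakeya_base by (meson bounded_iff compact_imp_bounded)
  have "norm v \<le> (\<Sum>k\<in>(UNIV :: 'a set). \<bar>B\<bar> + 1)" if v: "v \<in> kakeya_cylinder i j" for v
  proof -
    have "norm (v $ i, v $ j) \<le> B"
      using v B by (auto simp: kakeya_cylinder_def)
    then have "\<bar>v $ i\<bar> \<le> B" "\<bar>v $ j\<bar> \<le> B"
      using norm_fst_le[of "v $ i" "v $ j"] norm_snd_le[of "v $ j" "v $ i"] by auto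
    then have "\<bar>v $ k\<bar> \<le> \<bar>B\<bar> + 1" for k
      using v by (cases "k = i \<or> k = j") (force simp: kakeya_cylinder_def)+
    then have "(\<Sum>k\<in>UNIV. \<bar>v $ k\<bar>) \<le> (\<Sum>k\<in>(UNIV :: 'a set). \<bar>B\<bar> + 1)"
      by (intro sum_mono)
    then show ?thesis
      using norm_le_l1_cart[of v] by linarith
  qed
  then have "bounded (kakeya_cylinder i j)"
    by (auto simp: bounded_iff)
  then show ?thesis
    using closed_kakeya_cylinder by (simp add: compact_eq_bounded_closed)
qed

lemma kakeya_set_kakeya_cylinder:
  assumes "i \<noteq> j"
  shows "kakeya_set (kakeya_cylinder i (j :: 'n::finite))"
  unfolding kakeya_set_def
proof (intro allI impI)
  fix e :: "real ^ 'n" assume "norm e = 1"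
  then have e: "\<bar>e $ k\<bar> \<le> 1" for k
    using component_le_norm_cart[of e k] by simp
  then obtain b where b: "\<And>s. s \<in> {0..1} \<Longrightarrow> b + s *\<^sub>R (e $ i, e $ j) \<in> kakeya_base"
    using segment_in_kakeya_base by metis
  define a :: "real ^ 'n" where "a = (\<chi> k. if k = i then fst b else if k = j then snd b else 0)"
  have "a + s *\<^sub>R e \<in> kakeya_cylinder i j" if s: "s \<in> {0..1}" for s
  proof -
    have "((a + s *\<^sub>R e) $ i, (a + s *\<^sub>R e) $ j) = b + s *\<^sub>R (e $ i, e $ j)"
      using assms by (cases b) (simp add: a_def)
    moreover have "\<bar>(a + s *\<^sub>R e) $ k\<bar> \<le> 1" if "k \<noteq> i" "k \<noteq> j" for k
      using that s e[of k] by (auto simp: a_def abs_mult intro: mult_le_one)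
    ultimately show ?thesis
      using b[OF s] by (simp add: kakeya_cylinder_def)
  qed
  then have "closed_segment a (a + e) \<subseteq> kakeya_cylinder i j"
    by (auto simp: in_segment algebra_simps)
  then show "\<exists>a. closed_segment a (a + e) \<subseteq> kakeya_cylinder i j" by blast
qed

text \<open>
  The projection of the measure to the coordinates \<open>i\<close> and \<open>j\<close> inherits the decay and lives on a
  compact null set of the plane, so decay with \<open>s > 2\<close> would make it vanish.
\<close>

lemma fourier_dim_measure_le_2:
  fixes \<mu> :: "(real ^ 'n::finite) measure"
  assumes \<mu>: "nonzero_finite_borel_measure \<mu>" "measure_spt \<mu> \<subseteq> kakeya_cylinder i j" and "i \<noteq> j"
  shows "fourier_dim_measure \<mu> \<le> 2"
  unfolding fourier_dim_measure_def
proof (rule Sup_least, clarify)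
  fix s c :: real
  assume "s \<ge> 0" "c > 0"
    and decay: "\<forall>z. z \<noteq> 0 \<longrightarrow> cmod (fourier_measure \<mu> z) \<le> c * norm z powr (- s / 2)"
  have fin: "finite_measure \<mu>" and sets [measurable_cong]: "sets \<mu> = sets borel"
    and pos: "emeasure \<mu> UNIV \<noteq> 0"
    using \<mu>(1) by (auto simp: nonzero_finite_borel_measure_def)
  have sp: "space \<mu> = UNIV" using sets_eq_imp_space_eq[OF sets] by simp
  have "s \<le> 2"
  proof (rule ccontr)
    assume "\<not> s \<le> 2"
    define \<pi> where "\<pi> = (\<lambda>v :: real ^ 'n. (v $ i, v $ j))"
    have [measurable]: "\<pi> \<in> measurable \<mu> borel"
      unfolding \<pi>_def
      by (subst measurable_cong_sets[OF sets refl]) (intro borel_measurable_continuous_onI continuous_intros)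
    define \<nu> where "\<nu> = distr \<mu> borel \<pi>"
    have \<nu>: "finite_measure \<nu>" "sets \<nu> = sets borel"
      using fin by (auto simp: \<nu>_def intro: finite_measure.finite_measure_distr)
    have \<nu>_decay: "cmod (fourier_measure \<nu> z) \<le> c * norm z powr (- s / 2)" if "z \<noteq> 0" for z
    proof -
      define z' :: "real ^ 'n" where "z' = fst z *\<^sub>R axis i 1 + snd z *\<^sub>R axis j 1"
      have in_z': "z' \<bullet> v = z \<bullet> \<pi> v" for v
        by (simp add: z'_def \<pi>_def inner_add_left inner_axis' inner_prod_def)
      have "(norm z')\<^sup>2 = (norm z)\<^sup>2"
        using \<open>i \<noteq> j\<close> unfolding power2_norm_eq_inner in_z'
        by (simp add: z'_def \<pi>_def inner_prod_def axis_def)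
      then have nz: "norm z' = norm z" by simp
      have "fourier_measure \<nu> z = fourier_measure \<mu> z'"
        unfolding fourier_measure_def \<nu>_def in_z' by (subst integral_distr) auto
      moreover have "z' \<noteq> 0" using nz that by auto
      ultimately show ?thesis using decay nz by auto
    qed
    have "emeasure \<nu> kakeya_base = 0"
      by (rule emeasure_eq_0_if_fourier_decay[OF \<nu> \<nu>_decay _ compact_kakeya_base emeasure_kakeya_base])
         (use \<open>\<not> s \<le> 2\<close> in simp_all)
    moreover have "emeasure \<nu> kakeya_base = emeasure \<mu> (\<pi> -` kakeya_base)"
      unfolding \<nu>_def using closed_kakeya_base by (subst emeasure_distr) (auto simp: sp)
    moreover have "emeasure \<mu> UNIV \<le> emeasure \<mu> (\<pi> -` kakeya_base) + emeasure \<mu> (- kakeya_cylinder i j)"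
    proof -
      have "\<pi> -` kakeya_base \<in> sets \<mu>"
        using measurable_sets[of \<pi> \<mu> borel kakeya_base] closed_kakeya_base by (simp add: sp)
      moreover have "- kakeya_cylinder i j \<in> sets \<mu>"
        unfolding sets by (intro borel_open open_Compl closed_kakeya_cylinder)
      moreover have "UNIV = \<pi> -` kakeya_base \<union> - kakeya_cylinder i j"
        by (auto simp: \<pi>_def kakeya_cylinder_def)
      ultimately show ?thesis
        using emeasure_subadditive[of "\<pi> -` kakeya_base" \<mu> "- kakeya_cylinder i j"] by simp
    qed
    ultimately show False
      using emeasure_compl_eq_0_if_spt_subset[OF sets \<mu>(2)] pos by simp
  qed
  then have "ennreal s \<le> ennreal 2" by (rule ennreal_leI)
  then show "ennreal s \<le> 2" by simp
qed

lemma kakeya_measure_compl: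
  assumes "i \<noteq> j"
  shows "emeasure (kakeya_measure i j) (- kakeya_cylinder i (j :: 'n::finite)) = 0"
proof -
  have "kakeya_point i j p \<in> kakeya_cylinder i j" for p
    using assms besicovitch_point_in[of "fst p"] unit_clamp_bounds
    by (auto simp: kakeya_cylinder_def kakeya_point_def kakeya_base_def)
  then have "kakeya_point i j -` (- kakeya_cylinder i j) = {}" by blast
  then show ?thesis
    unfolding kakeya_measure_def using closed_kakeya_cylinder[of i j]
    by (subst emeasure_distr) (auto simp: open_Compl)
qed

lemma fourier_dim_measure_kakeya_measure_ge_2:
  assumes "i \<noteq> (j :: 'n::finite)"
  shows "2 \<le> fourier_dim_measure (kakeya_measure i j)"
  unfolding fourier_dim_measure_def
proof (rule Sup_upper, clarify, intro exI conjI allI impI)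
  show "(2 :: ennreal) = ennreal 2" by simp
  show "0 < real CARD('n) * (8 * pi)" by simp
  fix z :: "real ^ 'n" assume "z \<noteq> 0"
  then show "cmod (fourier_measure (kakeya_measure i j) z) \<le> real CARD('n) * (8 * pi) * norm z powr (- 2 / 2)"
    using fourier_kakeya_measure_decay[OF assms, of z]
    by (simp add: powr_minus divide_simps mult_ac)
qed simp

theorem proposition7p1:
  assumes "CARD('n::finite) \<ge> 3"
  shows "\<exists>K :: (real ^ 'n) set. compact K \<and> kakeya_set K \<and> fourier_dim K = 2"
proof -
  obtain i j :: 'n where ij: "i \<noteq> j"
  proof -
    have "\<not> CARD('n) \<le> Suc 0" using assms by simp
    then show thesis using that by (auto simp: card_le_Suc0_iff_eq)
  qed
  have "fourier_dim (kakeya_cylinder i j) \<le> 2"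
    unfolding fourier_dim_def using fourier_dim_measure_le_2[OF _ _ ij]
    by (intro Sup_least) (auto intro: min.coboundedI1)
  moreover have "2 \<le> fourier_dim (kakeya_cylinder i j)"
  proof -
    interpret prob_space "kakeya_measure i j" by (rule prob_space_kakeya_measure)
    have "nonzero_finite_borel_measure (kakeya_measure i j)"
      using emeasure_space_1 finite_measure_axioms
      by (auto simp: nonzero_finite_borel_measure_def kakeya_measure_def)
    moreover have "measure_spt (kakeya_measure i j) \<subseteq> kakeya_cylinder i j"
      by (intro measure_spt_subset_closed closed_kakeya_cylinder kakeya_measure_compl ij)
    ultimately have "min (fourier_dim_measure (kakeya_measure i j)) (of_nat DIM(real ^ 'n))
        \<le> fourier_dim (kakeya_cylinder i j)"
      unfolding fourier_dim_def by (intro Sup_upper) blast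
    moreover have "(2 :: ennreal) \<le> of_nat DIM(real ^ 'n)"
      using assms of_nat_mono[of 2 "CARD('n)", where 'a = ennreal] by simp
    ultimately show ?thesis
      using fourier_dim_measure_kakeya_measure_ge_2[OF ij] by (meson min.boundedI order_trans)
  qed
  ultimately have "fourier_dim (kakeya_cylinder i j) = 2"
    by (rule antisym)
  then show ?thesis
    using compact_kakeya_cylinder kakeya_set_kakeya_cylinder[OF ij] by blast
qed

end
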